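(* Let $\{Z_t\}_{t\ge0}$ denote the stationary Ornstein–Uhlenbeck process on the real line satisfying the stochastic differential equation $dZ=-Z\,dt+\sqrt2\,dW$ for a Brownian motion $W$ (so that $Z_t$ is standard normal for every $t$). There exists a finite constant $A>1$ such that for every non-empty non-random closed set $E\subseteq[0,1]$ and all $z>1$, $$A^{-1}\,\mathrm K_E\Big(\frac1{z^2}\Big)\bar\Phi(z)\ \le\ \mathrm P\Big\{\sup_{t\in E}Z_t\ge z\Big\}\ \le\ A\,\mathrm K_E\Big(\frac1{z^2}\Big)\bar\Phi(z).$$
   Context: $\Phi$ is the standard normal distribution function and $\bar\Phi=1-\Phi$. For $\varepsilon>0$, $\mathrm K_E(\varepsilon)$ (Kolmogorov $\varepsilon$-entropy, or packing number) is the maximal number $k$ of points $x_1,\dots,x_k\in E$ such that $|x_i-x_j|\ge\varepsilon$ whenever $i\ne j$. *)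

theory Defs
  imports "HOL-Probability.Probability"
begin

definition std_normal_tail :: "real \<Rightarrow> real" where
  "std_normal_tail z = 1 - cdf std_normal_distribution z"

text \<open>For unbounded \<open>E\<close> or \<open>\<epsilon> \<le> 0\<close> there need be no maximum, and the value is then
  unspecified.\<close>
definition packing_number :: "real set \<Rightarrow> real \<Rightarrow> nat" where
  "packing_number E \<epsilon> =
     (GREATEST k. \<exists>x :: nat \<Rightarrow> real. (\<forall>i\<in>{1..k}. x i \<in> E) \<and>
        (\<forall>i\<in>{1..k}. \<forall>j\<in>{1..k}. i \<noteq> j \<longrightarrow> \<epsilon> \<le> \<bar>x i - x j\<bar>))"

text \<open>Processes are indexed by \<open>real\<close>; only their values at times \<open>t \<ge> 0\<close> matter.\<close>

definition brownian_motion :: "'a measure \<Rightarrow> (real \<Rightarrow> 'a \<Rightarrow> real) \<Rightarrow> bool" where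
  "brownian_motion M W \<longleftrightarrow>
     prob_space M \<and>
     (\<forall>t\<ge>0. W t \<in> borel_measurable M) \<and>
     (AE \<omega> in M. W 0 \<omega> = 0) \<and>
     (\<forall>n. \<forall>t :: nat \<Rightarrow> real. 0 \<le> t 0 \<and> mono t \<longrightarrow>
        prob_space.indep_vars M (\<lambda>_. borel) (\<lambda>i \<omega>. W (t (Suc i)) \<omega> - W (t i) \<omega>) {..<n}) \<and>
     (\<forall>s t. 0 \<le> s \<and> s < t \<longrightarrow>
        distributed M lborel (\<lambda>\<omega>. W t \<omega> - W s \<omega>) (normal_density 0 (sqrt (t - s)))) \<and>
     (AE \<omega> in M. continuous_on {0..} (\<lambda>t. W t \<omega>))"

definition stationary_process :: "'a measure \<Rightarrow> (real \<Rightarrow> 'a \<Rightarrow> real) \<Rightarrow> bool" where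
  "stationary_process M Z \<longleftrightarrow>
     (\<forall>t\<ge>0. Z t \<in> borel_measurable M) \<and>
     (\<forall>h\<ge>0. distr M (\<Pi>\<^sub>M t\<in>{0..}. borel) (\<lambda>\<omega>. \<lambda>t\<in>{0..}. Z (t + h) \<omega>) =
             distr M (\<Pi>\<^sub>M t\<in>{0..}. borel) (\<lambda>\<omega>. \<lambda>t\<in>{0..}. Z t \<omega>))"

text \<open>The noise in \<open>dZ = -Z dt + sqrt 2 dW\<close> is additive, so the stochastic integral in the
  integrated equation is just \<open>sqrt 2 * W t\<close> and the remaining integral is pathwise.
  As usual for an SDE, the initial value is independent of the driving Brownian motion.\<close>

definition ou_solution ::
    "'a measure \<Rightarrow> (real \<Rightarrow> 'a \<Rightarrow> real) \<Rightarrow> (real \<Rightarrow> 'a \<Rightarrow> real) \<Rightarrow> bool" where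
  "ou_solution M W Z \<longleftrightarrow>
     prob_space.indep_set M
       {Z 0 -` B \<inter> space M |B. B \<in> sets borel}
       {(\<lambda>\<omega>. \<lambda>t\<in>{0..}. W t \<omega>) -` C \<inter> space M |C. C \<in> sets (\<Pi>\<^sub>M t\<in>{0..}. borel)} \<and>
     (AE \<omega> in M. \<forall>t\<ge>0. Z t \<omega> = Z 0 \<omega> - integral {0..t} (\<lambda>s. Z s \<omega>) + sqrt 2 * W t \<omega>)"

text \<open>All paths of \<open>Z\<close>, rather than almost all, are required to be continuous: \<open>M\<close> need not be
  complete, and this makes \<open>sup {Z t | t \<in> E}\<close> finite and measurable for closed
  \<open>E \<subseteq> {0..1}\<close>.\<close>

definition stationary_ou_process :: "'a measure \<Rightarrow> (real \<Rightarrow> 'a \<Rightarrow> real) \<Rightarrow> bool" where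
  "stationary_ou_process M Z \<longleftrightarrow>
     prob_space M \<and>
     stationary_process M Z \<and>
     (\<forall>\<omega>\<in>space M. continuous_on {0..} (\<lambda>t. Z t \<omega>)) \<and>
     (\<exists>W. brownian_motion M W \<and> ou_solution M W Z)"

end

theory Submission imports Defs begin

text \<open>The process \<open>exp t * Z t\<close> has independent centred Gaussian increments of variance
  \<open>exp (2 t) - exp (2 s)\<close>. We see this through Euler sums of the driving Brownian increments,
  with coefficients chosen so that the variances are exact; along every path they converge
  uniformly to \<open>exp t * Z t\<close>. Their laws and stationarity force \<open>Z t\<close> to be standard normal.

  Upper bound: a maximal packing with distance \<open>1 / z\<^sup>2\<close> gives a cover of \<open>E\<close> by intervals of
  length \<open>2 / z\<^sup>2\<close>, and by Levy's maximal inequality the supremum over one of them reaches \<open>z\<close> with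
  probability at most twice the tail at \<open>exp (- 2 / z\<^sup>2) * z\<close>, which is comparable to the tail
  at \<open>z\<close>.

  Lower bound: apply the second moment method to the number of packing points where \<open>Z\<close> exceeds
  \<open>z\<close>. If both \<open>Z s\<close> and \<open>Z t\<close> do, then \<open>Z s + Z t \<ge> 2 z\<close>, and this centred Gaussian has variance
  \<open>2 + 2 exp (- \<bar>s - t\<bar>)\<close>, so the probability is at most \<open>2 exp (- \<bar>s - t\<bar> z\<^sup>2 / 8)\<close> times the
  tail at \<open>z\<close>; over the packing points \<open>t\<close> these factors are dominated by a geometric
  series.\<close>

section \<open>Gaussian tails\<close>

text \<open>The substitution \<open>y = t + c * x\<close> turns the mass of \<open>B\<close> into an
  integral of the transformed density with Jacobian \<open>\<bar>c\<bar>\<close>, so a pointwise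
  comparison of densities suffices. Reflection, scaling and shifts of Gaussian tails are all
  instances.\<close>

lemma measure_std_normal_affine_le:
  fixes t c K :: real
  assumes [measurable]: "B \<in> sets borel" and c: "c \<noteq> 0" and K: "K \<ge> 0"
    and le: "\<And>x. t + c * x \<in> B \<Longrightarrow> \<bar>c\<bar> * std_normal_density (t + c * x) \<le> K * std_normal_density x"
  shows "measure std_normal_distribution B \<le> K * measure std_normal_distribution {x. t + c * x \<in> B}"
proof -
  interpret N: real_distribution std_normal_distribution by (rule real_dist_normal_dist)
  have [measurable]: "{x. t + c * x \<in> B} \<in> sets borel" by measurable
  have "emeasure std_normal_distribution B
      = (\<integral>\<^sup>+x. ennreal (std_normal_density x) * indicator B x \<partial>lborel)"
    by (simp add: emeasure_density)
  also have "\<dots> = ennreal \<bar>c\<bar> * (\<integral>\<^sup>+x. ennreal (std_normal_density (t + c * x)) * indicator B (t + c * x) \<partial>lborel)"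
    using c by (subst nn_integral_real_affine[of _ c t]) auto
  also have "\<dots> = (\<integral>\<^sup>+x. ennreal \<bar>c\<bar> * (ennreal (std_normal_density (t + c * x)) * indicator B (t + c * x)) \<partial>lborel)"
    by (rule nn_integral_cmult[symmetric]) measurable
  also have "\<dots> \<le> (\<integral>\<^sup>+x. ennreal K * (ennreal (std_normal_density x) * indicator {x. t + c * x \<in> B} x) \<partial>lborel)"
    using c K le
    by (intro nn_integral_mono) (auto simp: indicator_def ennreal_mult'[symmetric] intro!: ennreal_leI)
  also have "\<dots> = ennreal K * emeasure std_normal_distribution {x. t + c * x \<in> B}"
    by (subst nn_integral_cmult) (auto simp: emeasure_density)
  finally show ?thesis
    using K by (simp add: N.emeasure_eq_measure ennreal_mult'[symmetric])
qed

lemma measure_std_normal_singleton: "measure std_normal_distribution {x} = 0"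
proof -
  have "emeasure std_normal_distribution {x} = 0"
    by (subst emeasure_density) (auto simp: nn_integral_0_iff_AE intro!: AE_mp[OF AE_lborel_singleton[of x]])
  then show ?thesis by (simp add: measure_def)
qed

text \<open>The complement of \<open>{..z}\<close> is the open half-line; as the law has no atoms,
  the closed one has the same mass.\<close>

lemma std_normal_tail_eq: "std_normal_tail z = measure std_normal_distribution {z..}"
proof -
  interpret N: real_distribution std_normal_distribution by (rule real_dist_normal_dist)
  have "measure std_normal_distribution {..z} = measure std_normal_distribution {..<z}"
    using N.finite_measure_Union[of "{..<z}" "{z}"] measure_std_normal_singleton[of z]
    by (simp add: ivl_disj_un_singleton(2) del: Un_insert_right)
  moreover have "- {..<z} = {z..}" by auto
  ultimately show ?thesis
    using N.prob_compl[of "{..<z}"] by (simp add: std_normal_tail_def cdf_def Compl_eq_Diff_UNIV)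
qed

text \<open>Reflection at \<open>0\<close> bounds the mass of \<open>{..0}\<close> by that of
  \<open>{0..}\<close>, and the two add up to \<open>1\<close>. This is the symmetry behind the
  maximal inequality.\<close>

lemma half_le_std_normal_tail_0: "1 / 2 \<le> std_normal_tail 0"
proof -
  interpret N: real_distribution std_normal_distribution by (rule real_dist_normal_dist)
  have "measure std_normal_distribution {..0}
      \<le> 1 * measure std_normal_distribution {x. 0 + (- 1) * x \<in> {..0}}"
    by (rule measure_std_normal_affine_le) (auto simp: std_normal_density_def)
  also have "{x :: real. 0 + (- 1) * x \<in> {..0}} = {0..}" by auto
  finally have "measure std_normal_distribution {..0} \<le> std_normal_tail 0"
    by (simp add: std_normal_tail_eq)
  then show ?thesis by (simp add: std_normal_tail_def cdf_def)
qed

lemma isCont_std_normal_tail: "isCont std_normal_tail x"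
proof -
  interpret N: real_distribution std_normal_distribution by (rule real_dist_normal_dist)
  have "isCont (cdf std_normal_distribution) x"
    by (simp add: N.isCont_cdf measure_std_normal_singleton)
  then show ?thesis unfolding std_normal_tail_def[abs_def] by (intro continuous_intros)
qed

text \<open>Approximations of a path reach a threshold only up to an error
  \<open>\<epsilon>\<close>; continuity of the tail removes it at the end.\<close>

lemma le_std_normal_tailI:
  assumes c: "c > 0" and le: "\<And>\<epsilon>. \<epsilon> > 0 \<Longrightarrow> p \<le> K * std_normal_tail ((x - \<epsilon>) / c)"
  shows "p \<le> K * std_normal_tail (x / c)"
proof -
  have "(\<lambda>n. (x - 1 / real (Suc n)) / c) \<longlonglongrightarrow> (x - 0) / c"
    using LIMSEQ_inverse_real_of_nat c by (intro tendsto_intros) (auto simp: inverse_eq_divide)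
  then have "(\<lambda>n. K * std_normal_tail ((x - 1 / real (Suc n)) / c)) \<longlonglongrightarrow> K * std_normal_tail (x / c)"
    by (intro tendsto_mult_left isCont_tendsto_compose[OF isCont_std_normal_tail]) simp
  then show ?thesis
    by (rule LIMSEQ_le_const) (auto intro!: le)
qed

lemma std_normal_tail_antimono: "x \<le> y \<Longrightarrow> std_normal_tail y \<le> std_normal_tail x"
proof -
  interpret N: real_distribution std_normal_distribution by (rule real_dist_normal_dist)
  show "x \<le> y \<Longrightarrow> ?thesis"
    unfolding std_normal_tail_eq by (intro N.finite_measure_mono) auto
qed

text \<open>For \<open>x \<ge> z\<close> the exponential factor bounds the ratio of the densities at
  \<open>a * x\<close> and \<open>x\<close>; the factor \<open>a\<close> is the Jacobian.\<close>

lemma std_normal_tail_scale_le: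
  assumes a: "a \<ge> 1" and z: "z \<ge> 0"
  shows "std_normal_tail (a * z) \<le> a * exp (- ((a\<^sup>2 - 1) * z\<^sup>2 / 2)) * std_normal_tail z"
proof -
  have "measure std_normal_distribution {a * z..}
      \<le> (a * exp (- ((a\<^sup>2 - 1) * z\<^sup>2 / 2))) * measure std_normal_distribution {x. 0 + a * x \<in> {a * z..}}"
  proof (rule measure_std_normal_affine_le)
    fix x :: real assume "0 + a * x \<in> {a * z..}"
    then have "z \<le> x" using a by simp
    then have "z\<^sup>2 \<le> x\<^sup>2" using z by (simp add: power_mono)
    moreover have "a\<^sup>2 \<ge> 1" using a by simp
    ultimately have "(a\<^sup>2 - 1) * z\<^sup>2 \<le> (a\<^sup>2 - 1) * x\<^sup>2" by (intro mult_left_mono) auto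
    then have "- (a * x)\<^sup>2 / 2 \<le> - ((a\<^sup>2 - 1) * z\<^sup>2 / 2) + - x\<^sup>2 / 2"
      by (simp add: power_mult_distrib algebra_simps diff_divide_distrib)
    then have "exp (- (a * x)\<^sup>2 / 2) \<le> exp (- ((a\<^sup>2 - 1) * z\<^sup>2 / 2)) * exp (- x\<^sup>2 / 2)"
      by (simp add: exp_add[symmetric])
    then show "\<bar>a\<bar> * std_normal_density (0 + a * x)
        \<le> a * exp (- ((a\<^sup>2 - 1) * z\<^sup>2 / 2)) * std_normal_density x"
      using a by (simp add: std_normal_density_def field_simps)
  qed (use a in auto)
  also have "{x. 0 + a * x \<in> {a * z..}} = {z..}" using a by auto
  finally show ?thesis by (simp add: std_normal_tail_eq)
qed

text \<open>The density at \<open>s + x\<close> is \<open>exp (- (x * s) - s\<^sup>2 / 2)\<close>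
  times that at \<open>x\<close>, and \<open>x \<ge> y\<close> on the half-line.\<close>

lemma std_normal_tail_shift_le:
  assumes y: "y \<ge> 0" and s: "s \<ge> 0"
  shows "std_normal_tail (y + s) \<le> exp (- (y * s)) * std_normal_tail y"
proof -
  have "measure std_normal_distribution {y + s..}
      \<le> exp (- (y * s)) * measure std_normal_distribution {x. s + 1 * x \<in> {y + s..}}"
  proof (rule measure_std_normal_affine_le)
    fix x :: real assume "s + 1 * x \<in> {y + s..}"
    then have "y * s \<le> x * s" using s by (simp add: mult_right_mono)
    then have "2 * (y * s) \<le> s\<^sup>2 + 2 * (x * s)"
      using zero_le_power2[of s] by linarith
    then have "- (s + x)\<^sup>2 / 2 \<le> - (y * s) + - x\<^sup>2 / 2"
      by (simp add: power2_sum algebra_simps diff_divide_distrib add_divide_distrib)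
    then have "exp (- (s + x)\<^sup>2 / 2) \<le> exp (- (y * s)) * exp (- x\<^sup>2 / 2)"
      by (simp add: exp_add[symmetric])
    then show "\<bar>1\<bar> * std_normal_density (s + 1 * x) \<le> exp (- (y * s)) * std_normal_density x"
      by (simp add: std_normal_density_def field_simps)
  qed auto
  also have "{x. s + 1 * x \<in> {y + s..}} = {y..}" by auto
  finally show ?thesis by (simp add: std_normal_tail_eq)
qed

text \<open>At least half of the mass of \<open>{y..}\<close> lies in \<open>{y..<y + 1 / y}\<close>, and there the
  density changes by a controlled factor under the shift by \<open>z - y\<close>.\<close>
lemma std_normal_tail_le_tail:
  assumes y: "y > 0" and z: "y \<le> z"
  shows "std_normal_tail y \<le> 2 * exp ((y + 1 / y) * (z - y) + (z - y)\<^sup>2 / 2) * std_normal_tail z"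
proof -
  interpret N: real_distribution std_normal_distribution by (rule real_dist_normal_dist)
  define K where "K = exp ((y + 1 / y) * (z - y) + (z - y)\<^sup>2 / 2)"
  have "std_normal_tail (y + 1 / y) \<le> exp (- (y * (1 / y))) * std_normal_tail y"
    using y by (intro std_normal_tail_shift_le) auto
  \<comment> \<open>The shift by \<open>1 / y\<close> costs the factor \<open>exp (- 1)\<close>, and
    \<open>exp 1 \<ge> 1 + 1\<close>.\<close>
  also have "exp (- (y * (1 / y))) \<le> (1 / 2 :: real)"
    using y exp_ge_add_one_self[of 1] by (simp add: exp_minus field_simps)
  then have "exp (- (y * (1 / y))) * std_normal_tail y \<le> 1 / 2 * std_normal_tail y"
    by (rule mult_right_mono) (simp add: std_normal_tail_eq)
  finally have "std_normal_tail (y + 1 / y) \<le> 1 / 2 * std_normal_tail y" .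
  moreover have "std_normal_tail y
      = measure std_normal_distribution {y..<y + 1 / y} + std_normal_tail (y + 1 / y)"
  proof -
    have "1 / y > 0" using y by simp
    then have "{y..} = {y..<y + 1 / y} \<union> {y + 1 / y..}"
      by (intro ivl_disj_un_one(8)[symmetric]) (metis less_add_same_cancel1 less_imp_le)
    then show ?thesis
      unfolding std_normal_tail_eq by (auto intro!: N.finite_measure_Union)
  qed
  moreover have "measure std_normal_distribution {y..<y + 1 / y}
      \<le> K * measure std_normal_distribution {x. (y - z) + 1 * x \<in> {y..<y + 1 / y}}"
  proof (rule measure_std_normal_affine_le)
    fix x :: real assume "(y - z) + 1 * x \<in> {y..<y + 1 / y}"
    \<comment> \<open>Here \<open>x\<close> ranges over \<open>{z..<z + 1 / y}\<close>, and the
      density ratio is worst at its right end.\<close>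
    then have "x * (z - y) \<le> (z + 1 / y) * (z - y)" using z by (intro mult_right_mono) auto
    then have "- (y - z + x)\<^sup>2 / 2 \<le> ((y + 1 / y) * (z - y) + (z - y)\<^sup>2 / 2) + - x\<^sup>2 / 2"
    proof -
      have "- (y - z + x)\<^sup>2 / 2 = - x\<^sup>2 / 2 + x * (z - y) - (z - y)\<^sup>2 / 2"
        by (simp add: power2_eq_square field_simps)
      moreover have "(z + 1 / y) * (z - y) = (y + 1 / y) * (z - y) + (z - y)\<^sup>2"
        by (simp add: power2_eq_square algebra_simps)
      ultimately show ?thesis
        using \<open>x * (z - y) \<le> (z + 1 / y) * (z - y)\<close> by linarith
    qed
    then have "exp (- (y - z + x)\<^sup>2 / 2) \<le> K * exp (- x\<^sup>2 / 2)"
      unfolding K_def by (simp add: exp_add[symmetric])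
    then show "\<bar>1\<bar> * std_normal_density ((y - z) + 1 * x) \<le> K * std_normal_density x"
      by (simp add: std_normal_density_def field_simps)
  qed (auto simp: K_def)
  moreover have "measure std_normal_distribution {x. (y - z) + 1 * x \<in> {y..<y + 1 / y}}
      \<le> std_normal_tail z"
    unfolding std_normal_tail_eq by (intro N.finite_measure_mono) auto
  then have "K * measure std_normal_distribution {x. (y - z) + 1 * x \<in> {y..<y + 1 / y}}
      \<le> K * std_normal_tail z"
    by (rule mult_left_mono) (simp add: K_def)
  ultimately show ?thesis
    unfolding K_def[symmetric] by simp
qed

lemma (in prob_space) distributed_normal_tail:
  assumes X: "distributed M lborel X (normal_density 0 \<sigma>)" and \<sigma>: "\<sigma> > 0"
  shows "prob {\<omega> \<in> space M. X \<omega> \<ge> x} = std_normal_tail (x / \<sigma>)"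
proof -
  have *: "distributed M lborel (\<lambda>\<omega>. (X \<omega> - 0) / \<sigma>) std_normal_density"
    using normal_standard_normal_convert[of \<sigma> X 0] X \<sigma> by simp
  have "distr M lborel (\<lambda>\<omega>. (X \<omega> - 0) / \<sigma>) = std_normal_distribution"
    using * by (rule distributed_distr_eq_density)
  then have "std_normal_tail (x / \<sigma>) = measure (distr M lborel (\<lambda>\<omega>. (X \<omega> - 0) / \<sigma>)) {x / \<sigma>..}"
    by (simp add: std_normal_tail_eq)
  also have "\<dots> = prob ((\<lambda>\<omega>. (X \<omega> - 0) / \<sigma>) -` {x / \<sigma>..} \<inter> space M)"
    using distributed_measurable[OF *] by (intro measure_distr) auto
  also have "(\<lambda>\<omega>. (X \<omega> - 0) / \<sigma>) -` {x / \<sigma>..} \<inter> space M = {\<omega> \<in> space M. X \<omega> \<ge> x}"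
    using \<sigma> by (auto simp: divide_le_cancel)
  finally show ?thesis by simp
qed

section \<open>Limits of events and the maximal inequality\<close>

text \<open>Almost surely \<open>A\<close> lies in the limit inferior of the \<open>B n\<close>.
  That is the increasing union of the intersections over \<open>n \<ge> m\<close>, each of which is
  contained in \<open>B m\<close>.\<close>

lemma (in prob_space) prob_le_if_eventually:
  fixes B :: "nat \<Rightarrow> 'a set"
  assumes A: "A \<in> events" and B: "\<And>n. B n \<in> events"
    and ev: "AE \<omega> in M. \<omega> \<in> A \<longrightarrow> (\<forall>\<^sub>F n in sequentially. \<omega> \<in> B n)"
    and le: "\<And>n. prob (B n) \<le> p"
  shows "prob A \<le> p"
proof -
  have [measurable]: "A \<in> events" "\<And>n. B n \<in> events" using A B by auto
  have "(\<lambda>m. prob (\<Inter>n\<in>{m..}. B n)) \<longlonglongrightarrow> prob (\<Union>m. \<Inter>n\<in>{m..}. B n)"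
    by (rule finite_Lim_measure_incseq) (auto simp: incseq_def)
  moreover have "prob (\<Inter>n\<in>{m..}. B n) \<le> p" for m
    using le[of m] finite_measure_mono[of "\<Inter>n\<in>{m..}. B n" "B m"] by force
  ultimately have "prob (\<Union>m. \<Inter>n\<in>{m..}. B n) \<le> p"
    by (intro LIMSEQ_le_const2) auto
  moreover have "prob A \<le> prob (\<Union>m. \<Inter>n\<in>{m..}. B n)"
    using ev by (intro finite_measure_mono_AE) (auto simp: eventually_sequentially elim!: eventually_mono)
  ultimately show ?thesis by simp
qed

text \<open>On the event that the partial sums reach \<open>x\<close> first at time \<open>k\<close>, the rest of the sum is
  independent of the past and nonnegative with probability at least \<open>1 / 2\<close>.\<close>
lemma (in prob_space) levy_maximal_inequality:
  fixes X :: "nat \<Rightarrow> 'a \<Rightarrow> real"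
  assumes ind: "indep_vars (\<lambda>_. borel) X {..n}"
    and half: "\<And>k. k \<le> n \<Longrightarrow> prob {\<omega> \<in> space M. 0 \<le> (\<Sum>i\<in>{k<..n}. X i \<omega>)} \<ge> 1 / 2"
  shows "prob {\<omega> \<in> space M. \<exists>k\<le>n. x \<le> (\<Sum>i\<le>k. X i \<omega>)}
    \<le> 2 * prob {\<omega> \<in> space M. x \<le> (\<Sum>i\<le>n. X i \<omega>)}"
proof -
  have X[measurable]: "X i \<in> borel_measurable M" if "i \<le> n" for i
    using ind that by (auto simp: indep_vars_def)
  \<comment> \<open>\<open>P k\<close> says that \<open>k\<close> is the first passage index. It is
    a predicate on sequences, so that \<open>F k\<close> becomes the preimage of a set in the
    product space over \<open>{..k}\<close>.\<close>
  define P where "P k f \<longleftrightarrow> x \<le> (\<Sum>i\<le>k. f i) \<and> (\<forall>j<k. (\<Sum>i\<le>j. f i) < x)"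
    for k and f :: "nat \<Rightarrow> real"
  define F where "F k = {\<omega> \<in> space M. P k (\<lambda>i. X i \<omega>)}" for k
  define R where "R k = {\<omega> \<in> space M. 0 \<le> (\<Sum>i\<in>{k<..n}. X i \<omega>)}" for k
  have F[measurable]: "F k \<in> events" if "k \<le> n" for k
  proof -
    have [measurable]: "(\<lambda>\<omega>. \<Sum>i\<le>j. X i \<omega>) \<in> borel_measurable M" if "j \<le> k" for j
      using that \<open>k \<le> n\<close> by (intro borel_measurable_sum X) auto
    show ?thesis unfolding F_def P_def by measurable
  qed
  have R[measurable]: "R k \<in> events" if "k \<le> n" for k
  proof -
    have [measurable]: "(\<lambda>\<omega>. \<Sum>i\<in>{k<..n}. X i \<omega>) \<in> borel_measurable M"
      by (intro borel_measurable_sum X) auto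
    show ?thesis unfolding R_def by measurable
  qed
  have disj: "disjoint_family_on F {..n}"
    unfolding disjoint_family_on_def F_def P_def by (auto, metis linorder_neqE_nat not_le)
  have indFR: "prob (F k \<inter> R k) = prob (F k) * prob (R k)" if k: "k \<le> n" for k
  proof -
    let ?A = "{f \<in> space (PiM {..k} (\<lambda>_. borel)). P k f}"
    let ?B = "{f \<in> space (PiM {k<..n} (\<lambda>_. borel)). 0 \<le> (\<Sum>i\<in>{k<..n}. f i :: real)}"
    have "indep_var (PiM {..k} (\<lambda>_. borel)) (\<lambda>\<omega>. restrict (\<lambda>i. X i \<omega>) {..k})
       (PiM {k<..n} (\<lambda>_. borel)) (\<lambda>\<omega>. restrict (\<lambda>i. X i \<omega>) {k<..n})"
      by (rule indep_var_restrict[OF ind]) (use k in auto)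
    moreover have "?A \<in> sets (PiM {..k} (\<lambda>_. borel))"
    proof -
      have [measurable]: "(\<lambda>f. \<Sum>i\<le>j. f i :: real) \<in> borel_measurable (PiM {..k} (\<lambda>_. borel))"
        if "j \<le> k" for j
        using that by (intro borel_measurable_sum measurable_component_singleton) auto
      show ?thesis unfolding P_def by measurable
    qed
    moreover have "?B \<in> sets (PiM {k<..n} (\<lambda>_. borel))"
      by measurable
    ultimately have "prob ((\<lambda>\<omega>. (restrict (\<lambda>i. X i \<omega>) {..k}, restrict (\<lambda>i. X i \<omega>) {k<..n})) -` (?A \<times> ?B) \<inter> space M)
      = prob ((\<lambda>\<omega>. restrict (\<lambda>i. X i \<omega>) {..k}) -` ?A \<inter> space M)
        * prob ((\<lambda>\<omega>. restrict (\<lambda>i. X i \<omega>) {k<..n}) -` ?B \<inter> space M)"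
      by (rule indep_varD)
    moreover have "(\<lambda>\<omega>. restrict (\<lambda>i. X i \<omega>) {..k}) -` ?A \<inter> space M = F k"
    proof -
      have "(\<Sum>i\<le>j. restrict f {..k} i) = (\<Sum>i\<le>j. f i)" if "j \<le> k" for j and f :: "nat \<Rightarrow> real"
        using that by (intro sum.cong) auto
      then have "P k (restrict f {..k}) = P k f" for f
        unfolding P_def by (metis less_imp_le order_refl)
      then show ?thesis by (auto simp: F_def space_PiM)
    qed
    moreover have "(\<lambda>\<omega>. restrict (\<lambda>i. X i \<omega>) {k<..n}) -` ?B \<inter> space M = R k"
      by (auto simp: R_def space_PiM)
    moreover have "(\<lambda>\<omega>. (restrict (\<lambda>i. X i \<omega>) {..k}, restrict (\<lambda>i. X i \<omega>) {k<..n})) -` (?A \<times> ?B) \<inter> space M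
       = ((\<lambda>\<omega>. restrict (\<lambda>i. X i \<omega>) {..k}) -` ?A \<inter> space M)
        \<inter> ((\<lambda>\<omega>. restrict (\<lambda>i. X i \<omega>) {k<..n}) -` ?B \<inter> space M)"
      by auto
    ultimately show ?thesis by simp
  qed
  have "{\<omega> \<in> space M. \<exists>k\<le>n. x \<le> (\<Sum>i\<le>k. X i \<omega>)} = (\<Union>k\<in>{..n}. F k)"
  proof (intro equalityI subsetI)
    fix \<omega> assume "\<omega> \<in> {\<omega> \<in> space M. \<exists>k\<le>n. x \<le> (\<Sum>i\<le>k. X i \<omega>)}"
    then obtain k where k: "\<omega> \<in> space M" "k \<le> n" "x \<le> (\<Sum>i\<le>k. X i \<omega>)" by auto
    define m where "m = (LEAST k. x \<le> (\<Sum>i\<le>k. X i \<omega>))"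
    have "m \<le> k" unfolding m_def by (rule Least_le) fact
    moreover have "x \<le> (\<Sum>i\<le>m. X i \<omega>)" unfolding m_def by (rule LeastI) fact
    moreover have "(\<Sum>i\<le>j. X i \<omega>) < x" if "j < m" for j
      using not_less_Least[of j "\<lambda>k. x \<le> (\<Sum>i\<le>k. X i \<omega>)"] that by (simp add: m_def)
    ultimately show "\<omega> \<in> (\<Union>k\<in>{..n}. F k)" using k by (auto simp: F_def P_def intro!: bexI[of _ m])
  qed (auto simp: F_def P_def)
  then have "prob {\<omega> \<in> space M. \<exists>k\<le>n. x \<le> (\<Sum>i\<le>k. X i \<omega>)} = (\<Sum>k\<le>n. prob (F k))"
    using disj F by (simp add: finite_measure_finite_Union image_subset_iff)
  \<comment> \<open>\<open>half\<close> bounds \<open>prob (R k)\<close> from below, and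
    independence merges it with \<open>prob (F k)\<close>.\<close>
  also have "\<dots> \<le> (\<Sum>k\<le>n. 2 * prob (F k \<inter> R k))"
  proof (rule sum_mono)
    fix k assume "k \<in> {..n}"
    then have "prob (F k) * (1 / 2) \<le> prob (F k) * prob (R k)"
      using half[of k] by (intro mult_left_mono) (auto simp: R_def)
    then show "prob (F k) \<le> 2 * prob (F k \<inter> R k)" using indFR[of k] \<open>k \<in> {..n}\<close> by simp
  qed
  also have "\<dots> = 2 * prob (\<Union>k\<in>{..n}. F k \<inter> R k)"
    using disj F R
    by (subst finite_measure_finite_Union) (auto simp: sum_distrib_left disjoint_family_on_def)
  also have "prob (\<Union>k\<in>{..n}. F k \<inter> R k) \<le> prob {\<omega> \<in> space M. x \<le> (\<Sum>i\<le>n. X i \<omega>)}"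
  proof (rule finite_measure_mono)
    show "(\<Union>k\<in>{..n}. F k \<inter> R k) \<subseteq> {\<omega> \<in> space M. x \<le> (\<Sum>i\<le>n. X i \<omega>)}"
    proof
      fix \<omega> assume "\<omega> \<in> (\<Union>k\<in>{..n}. F k \<inter> R k)"
      then obtain k where k: "k \<le> n" "\<omega> \<in> F k" "\<omega> \<in> R k" by auto
      have "{..n} = {..k} \<union> {k<..n}" "{..k} \<inter> {k<..n} = {}" using k by auto
      then have "(\<Sum>i\<le>n. X i \<omega>) = (\<Sum>i\<le>k. X i \<omega>) + (\<Sum>i\<in>{k<..n}. X i \<omega>)"
        by (simp add: sum.union_disjoint)
      then show "\<omega> \<in> {\<omega> \<in> space M. x \<le> (\<Sum>i\<le>n. X i \<omega>)}"
        using k by (auto simp: F_def R_def P_def)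
    qed
    have [measurable]: "(\<lambda>\<omega>. \<Sum>i\<le>n. X i \<omega>) \<in> borel_measurable M"
      by (intro borel_measurable_sum X) auto
    show "{\<omega> \<in> space M. x \<le> (\<Sum>i\<le>n. X i \<omega>)} \<in> events" by measurable
  qed
  finally show ?thesis by simp
qed

section \<open>Euler sums along a path\<close>

text \<open>The root mean square of \<open>exp\<close> over \<open>{s..s'}\<close>. With the factor
  \<open>sqrt 2\<close> it gives a Brownian increment over this interval exactly the variance
  \<open>exp (2 * s') - exp (2 * s)\<close>.\<close>

definition euler_coeff :: "real \<Rightarrow> real \<Rightarrow> real" where
  "euler_coeff s s' = sqrt ((exp (2 * s') - exp (2 * s)) / (2 * (s' - s)))"

text \<open>All four follow from the tangent inequality for \<open>exp\<close> at one of the end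
  points, for the coefficient with doubled arguments: a root mean square lies between the extreme
  values.\<close>

lemma euler_coeff_bounds:
  assumes "s < s'"
  shows "exp s * (s' - s) \<le> exp s' - exp s" "exp s' - exp s \<le> exp s' * (s' - s)"
    "exp s \<le> euler_coeff s s'" "euler_coeff s s' \<le> exp s'"
proof -
  have lower: "exp x * (y - x) \<le> exp y - exp x" for x y :: real
  proof -
    have "exp x * (1 + (y - x)) \<le> exp x * exp (y - x)"
      by (intro mult_left_mono exp_ge_add_one_self) simp
    then show ?thesis by (simp add: exp_add[symmetric] algebra_simps)
  qed
  show "exp s * (s' - s) \<le> exp s' - exp s" by (rule lower)
  show "exp s' - exp s \<le> exp s' * (s' - s)" using lower[of s' s] by (simp add: algebra_simps)
  have sq: "exp (2 * x) = (exp x)\<^sup>2" for x :: real by (simp add: exp_double)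
  have "(exp s)\<^sup>2 \<le> (exp (2 * s') - exp (2 * s)) / (2 * (s' - s))"
    using lower[of "2 * s" "2 * s'"] assms by (simp add: sq[symmetric] field_simps)
  then show "exp s \<le> euler_coeff s s'" unfolding euler_coeff_def by (rule real_le_rsqrt)
  have "(exp (2 * s') - exp (2 * s)) / (2 * (s' - s)) \<le> (exp s')\<^sup>2"
    using lower[of "2 * s'" "2 * s"] assms by (simp add: sq[symmetric] field_simps)
  then show "euler_coeff s s' \<le> exp s'" unfolding euler_coeff_def by (intro real_le_lsqrt) auto
qed

text \<open>By the integrated equation, \<open>z s' - z s + integral {s..s'} z\<close> will be
  \<open>sqrt 2\<close> times the driving increment. The error is the step length times a quantity
  that vanishes with the mesh, so the errors of all steps together still tend to
  \<open>0\<close>.\<close>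

lemma euler_step:
  fixes z :: "real \<Rightarrow> real"
  assumes s: "s < s'" and z: "continuous_on {s..s'} z"
    and osc: "\<And>r. r \<in> {s..s'} \<Longrightarrow> \<bar>z r - z s\<bar> \<le> \<omega>" and B: "\<bar>z s\<bar> \<le> B"
  shows "\<bar>exp s' * z s' - exp s * z s - euler_coeff s s' * (z s' - z s + integral {s..s'} z)\<bar>
    \<le> (s' - s) * exp s' * (2 * \<omega> + (s' - s) * B)"
proof -
  define c h where "c = euler_coeff s s'" and "h = s' - s"
  have h: "h > 0" using s by (simp add: h_def)
  note bd = euler_coeff_bounds[OF s, folded c_def h_def]
  have c: "0 \<le> c" using bd(3) exp_ge_zero[of s] by linarith
  have int: "z integrable_on {s..s'}" using z by (rule integrable_continuous_real)
  have "norm (integral {s..s'} (\<lambda>r. z r - z s)) \<le> \<omega> * (s' - s)"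
    using s osc z by (intro integral_bound) (auto intro!: continuous_intros)
  moreover have "integral {s..s'} (\<lambda>r. z r - z s) = integral {s..s'} z - h * z s"
    using s int by (subst Henstock_Kurzweil_Integration.integral_diff) (auto simp: h_def)
  ultimately have i: "\<bar>integral {s..s'} z - h * z s\<bar> \<le> \<omega> * h" by (simp add: h_def)
  \<comment> \<open>The three errors: \<open>c\<close> replaces \<open>exp s'\<close> at the
    increment of \<open>z\<close>, \<open>c * h\<close> replaces \<open>exp s' - exp s\<close> at
    the value of \<open>z\<close>, and the left end point value replaces the integral.\<close>
  have "exp s' * z s' - exp s * z s - c * (z s' - z s + integral {s..s'} z)
    = (exp s' - c) * (z s' - z s) + (exp s' - exp s - c * h) * z s
      - c * (integral {s..s'} z - h * z s)"
    by (simp add: algebra_simps)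
  moreover have "\<bar>(exp s' - c) * (z s' - z s)\<bar> \<le> (exp s' * h) * \<omega>"
    unfolding abs_mult using bd osc[of s'] s by (intro mult_mono) auto
  moreover have "\<bar>(exp s' - exp s - c * h) * z s\<bar> \<le> ((exp s' * h) * h) * B"
    unfolding abs_mult
  proof (rule mult_mono)
    \<comment> \<open>Both \<open>exp s' - exp s\<close> and \<open>c * h\<close> lie between
      \<open>exp s * h\<close> and \<open>exp s' * h\<close>, so their difference is of second order
      in \<open>h\<close>.\<close>
    have "exp s * h \<le> c * h" "c * h \<le> exp s' * h"
      using bd h by (auto intro: mult_right_mono)
    moreover have "(exp s' - exp s) * h \<le> (exp s' * h) * h"
      using bd(2) h by (intro mult_right_mono) auto
    ultimately show "\<bar>exp s' - exp s - c * h\<bar> \<le> exp s' * h * h"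
      using bd(1,2) by (auto simp: abs_le_iff algebra_simps)
  qed (use B h in auto)
  moreover have "\<bar>c * (integral {s..s'} z - h * z s)\<bar> \<le> exp s' * (\<omega> * h)"
    unfolding abs_mult using bd(4) c i by (intro mult_mono) auto
  ultimately have "\<bar>exp s' * z s' - exp s * z s - c * (z s' - z s + integral {s..s'} z)\<bar>
      \<le> (exp s' * h) * \<omega> + ((exp s' * h) * h) * B + exp s' * (\<omega> * h)"
    by linarith
  also have "\<dots> = h * exp s' * (2 * \<omega> + h * B)" by (simp add: algebra_simps)
  finally show ?thesis unfolding c_def h_def .
qed

definition grid :: "real \<Rightarrow> nat \<Rightarrow> nat \<Rightarrow> real" where
  "grid b n k = real k * b / real n"

lemma grid_0 [simp]: "grid b n 0 = 0"
  by (simp add: grid_def)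

lemma grid_end [simp]: "n > 0 \<Longrightarrow> grid b n n = b"
  by (simp add: grid_def)

lemma grid_Suc: "grid b n (Suc k) = grid b n k + b / real n"
  by (simp add: grid_def add_divide_distrib algebra_simps)

lemma grid_nonneg: "b \<ge> 0 \<Longrightarrow> 0 \<le> grid b n k"
  by (simp add: grid_def)

lemma grid_le: "b \<ge> 0 \<Longrightarrow> k \<le> n \<Longrightarrow> grid b n k \<le> b"
  \<comment> \<open>For \<open>n = 0\<close>, division by zero makes the grid constantly
    \<open>0\<close>.\<close>
  by (cases "n = 0") (auto simp: grid_def field_simps intro: mult_left_mono)

text \<open>A function of a single path \<open>w\<close>, so that convergence is settled
  deterministically before probability enters.\<close>

definition euler_sum :: "(real \<Rightarrow> real) \<Rightarrow> real \<Rightarrow> nat \<Rightarrow> nat \<Rightarrow> real" where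
  "euler_sum w b n k = (\<Sum>j<k. euler_coeff (grid b n j) (grid b n (Suc j)) * sqrt 2
     * (w (grid b n (Suc j)) - w (grid b n j)))"

text \<open>Uniform continuity on \<open>{0..b}\<close> bounds each local error by
  \<open>h * K\<close> with small \<open>K\<close>, and the steps have total length at most
  \<open>b\<close>. The bound is uniform in \<open>k\<close>, as the maximal inequality
  requires.\<close>

lemma euler_sum_approx:
  fixes z w :: "real \<Rightarrow> real"
  assumes b: "b > 0" and cont: "continuous_on {0..} z" and \<epsilon>: "\<epsilon> > 0"
    and eq: "\<And>t. t \<ge> 0 \<Longrightarrow> z t = z 0 - integral {0..t} z + sqrt 2 * w t"
  shows "\<forall>\<^sub>F n in sequentially. \<forall>k\<le>n.
    \<bar>z 0 + euler_sum w b n k - exp (grid b n k) * z (grid b n k)\<bar> < \<epsilon>"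
proof -
  have cont': "continuous_on {0..b} z" by (rule continuous_on_subset[OF cont]) auto
  obtain B where B: "\<And>t. t \<in> {0..b} \<Longrightarrow> \<bar>z t\<bar> \<le> B"
    using compact_imp_bounded[OF compact_continuous_image[OF cont']] by (fastforce simp: bounded_iff)
  have B0: "B \<ge> 0" using B[of 0] b by force
  \<comment> \<open>With this choice the oscillation contributes \<open>\<epsilon> / 4\<close> in
    total; the term with the mesh is kept below \<open>\<epsilon> / 2\<close>.\<close>
  define \<omega> where "\<omega> = \<epsilon> / (8 * b * exp b)"
  have \<omega>: "\<omega> > 0" using b \<epsilon> by (simp add: \<omega>_def)
  have "uniformly_continuous_on {0..b} z"
    using cont' by (rule compact_uniformly_continuous) auto
  then obtain \<delta> where \<delta>: "\<delta> > 0"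
    "\<And>x y. x \<in> {0..b} \<Longrightarrow> y \<in> {0..b} \<Longrightarrow> dist y x < \<delta> \<Longrightarrow> dist (z y) (z x) < \<omega>"
    using \<omega> unfolding uniformly_continuous_on_def by metis
  have lim: "(\<lambda>n. b / real n) \<longlonglongrightarrow> 0" by (rule lim_const_over_n)
  then have "\<forall>\<^sub>F n in sequentially. b / real n < \<delta>"
    using \<delta>(1) by (rule order_tendstoD)
  moreover have "(\<lambda>n. b * exp b * (b / real n * B)) \<longlonglongrightarrow> 0"
    by (rule tendsto_eq_intros lim refl)+ simp
  then have "\<forall>\<^sub>F n in sequentially. b * exp b * (b / real n * B) < \<epsilon> / 2"
    using \<epsilon> by (intro order_tendstoD) auto
  ultimately show ?thesis
    using eventually_gt_at_top[of 0]
  proof eventually_elim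
    fix n :: nat assume n: "b / real n < \<delta>" "b * exp b * (b / real n * B) < \<epsilon> / 2" "n > 0"
    define h where "h = b / real n"
    have h: "h > 0" using b n by (simp add: h_def)
    define K where "K = exp b * (2 * \<omega> + h * B)"
    have K: "K \<ge> 0" using \<omega> h B0 by (simp add: K_def)
    define G where "G = grid b n"
    have GS: "G (Suc j) = G j + h" for j by (simp add: G_def grid_Suc h_def)
    show "\<forall>k\<le>n. \<bar>z 0 + euler_sum w b n k - exp (grid b n k) * z (grid b n k)\<bar> < \<epsilon>"
    proof (intro allI impI)
      fix k assume k: "k \<le> n"
      let ?d = "\<lambda>j. exp (G (Suc j)) * z (G (Suc j)) - exp (G j) * z (G j)
           - euler_coeff (G j) (G (Suc j)) * sqrt 2 * (w (G (Suc j)) - w (G j))"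
      have step: "\<bar>?d j\<bar> \<le> h * K" if "j < k" for j
      proof -
        have G: "0 \<le> G j" "G (Suc j) \<le> b" "G j < G (Suc j)"
          using b k that h GS[of j] grid_nonneg[of b n j] grid_le[of b "Suc j" n] by (auto simp: G_def)
        have sub: "{G j..G (Suc j)} \<subseteq> {0..b}" using G by auto
        \<comment> \<open>Subtracting the equation at two consecutive grid points cancels
          \<open>z 0\<close>.\<close>
        have "sqrt 2 * (w (G (Suc j)) - w (G j)) = z (G (Suc j)) - z (G j)
            + (integral {0..G (Suc j)} z - integral {0..G j} z)"
          using eq[of "G j"] eq[of "G (Suc j)"] G by (simp add: algebra_simps)
        also have "integral {0..G (Suc j)} z = integral {0..G j} z + integral {G j..G (Suc j)} z"
          using G by (intro Henstock_Kurzweil_Integration.integral_combine[symmetric])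
            (auto intro!: integrable_continuous_real continuous_on_subset[OF cont'])
        finally have "?d j = exp (G (Suc j)) * z (G (Suc j)) - exp (G j) * z (G j)
           - euler_coeff (G j) (G (Suc j))
             * (z (G (Suc j)) - z (G j) + integral {G j..G (Suc j)} z)"
          by (simp add: mult.assoc)
        also have "\<bar>\<dots>\<bar> \<le> (G (Suc j) - G j) * exp (G (Suc j)) * (2 * \<omega> + (G (Suc j) - G j) * B)"
        proof (rule euler_step)
          show "continuous_on {G j..G (Suc j)} z" using cont' sub by (rule continuous_on_subset)
          show "\<bar>z r - z (G j)\<bar> \<le> \<omega>" if "r \<in> {G j..G (Suc j)}" for r
            using \<delta>(2)[of "G j" r] that sub GS[of j] n(1) by (auto simp: dist_real_def h_def)
          show "\<bar>z (G j)\<bar> \<le> B" using B sub G by auto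
        qed (use G in auto)
        also have "\<dots> \<le> h * K"
          unfolding K_def GS using G(2) h \<omega> B0 by (auto simp: GS mult.assoc intro!: mult_mono)
        finally show ?thesis .
      qed
      have "\<bar>\<Sum>j<k. ?d j\<bar> \<le> (\<Sum>j<k. \<bar>?d j\<bar>)" by (rule sum_abs)
      also have "\<dots> \<le> (\<Sum>j<k. h * K)" using step by (intro sum_mono) auto
      also have "\<dots> = real k * h * K" by simp
      also have "\<dots> \<le> b * K"
        using grid_le[of b k n] b k K by (intro mult_right_mono) (auto simp: grid_def h_def)
      also have "\<dots> = b * exp b * (2 * \<omega>) + b * exp b * (h * B)"
        by (simp add: K_def algebra_simps)
      also have "\<dots> < \<epsilon>"
        using n(2) b \<epsilon> by (simp add: h_def \<omega>_def)
      finally have "\<bar>\<Sum>j<k. ?d j\<bar> < \<epsilon>" .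
      moreover have "(\<Sum>j<k. ?d j) = exp (G k) * z (G k) - z 0 - euler_sum w b n k"
        using sum_lessThan_telescope[of "\<lambda>j. exp (G j) * z (G j)" k]
        by (simp add: sum_subtractf euler_sum_def G_def[symmetric]) (simp add: G_def)
      ultimately show "\<bar>z 0 + euler_sum w b n k - exp (grid b n k) * z (grid b n k)\<bar> < \<epsilon>"
        by (simp add: G_def abs_minus_commute algebra_simps)
    qed
  qed
qed

section \<open>One-dimensional laws\<close>

text \<open>Since \<open>sets L\<close> is closed under intersections, the product formula on
  rectangles suffices: \<open>joint\<close> splits off \<open>X\<close>, and independence of the
  \<open>Y j\<close> factors the rest. Index \<open>0\<close> carries \<open>X\<close> and index
  \<open>Suc j\<close> carries \<open>Y j\<close>.\<close>

lemma (in prob_space) indep_vars_case_nat: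
  assumes X: "X \<in> measurable M L" and Y: "indep_vars (\<lambda>_. L) Y {..<n}" and n: "n > 0"
    and joint: "\<And>B A. B \<in> sets L \<Longrightarrow> (\<And>j. j < n \<Longrightarrow> A j \<in> sets L) \<Longrightarrow>
      prob ((X -` B \<inter> space M) \<inter> (\<Inter>j\<in>{..<n}. Y j -` A j \<inter> space M))
      = prob (X -` B \<inter> space M) * prob (\<Inter>j\<in>{..<n}. Y j -` A j \<inter> space M)"
  shows "indep_vars (\<lambda>_. L) (case_nat X Y) {..n}"
proof -
  let ?N = "\<lambda>_::nat. L"
  have ins: "{..n} = insert 0 (Suc ` {..<n})"
    by (simp add: lessThan_Suc_eq_insert_0 lessThan_Suc_atMost[symmetric])
  have "?thesis \<longleftrightarrow> (\<forall>A\<in>(\<Pi> i\<in>{..n}. sets (?N i)).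
      prob (\<Inter>j\<in>{..n}. case_nat X Y j -` A j \<inter> space M)
      = (\<Prod>j\<in>{..n}. prob (case_nat X Y j -` A j \<inter> space M)))"
  proof (rule indep_vars_finite)
    show "random_variable (?N i) (case_nat X Y i)" if "i \<in> {..n}" for i
      using that X Y by (cases i) (auto simp: indep_vars_def)
  qed (auto simp: sets.sigma_sets_eq sets.Int_stable sets.space_closed sets.sets_into_space)
  also have "\<dots>"
  proof
    fix A assume A: "A \<in> (\<Pi> i\<in>{..n}. sets (?N i))"
    have A0: "A 0 \<in> sets L" using A by (auto simp: Pi_iff)
    have AS: "A (Suc j) \<in> sets L" if "j < n" for j
      using A that by (auto simp: Pi_iff dest!: bspec[of _ _ "Suc j"])
    have "(\<Inter>j\<in>{..n}. case_nat X Y j -` A j \<inter> space M)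
      = (X -` A 0 \<inter> space M) \<inter> (\<Inter>j\<in>{..<n}. Y j -` A (Suc j) \<inter> space M)"
      unfolding ins by auto
    also have "prob \<dots> = prob (X -` A 0 \<inter> space M)
        * prob (\<Inter>j\<in>{..<n}. Y j -` A (Suc j) \<inter> space M)"
      by (rule joint[OF A0 AS])
    also have "prob (\<Inter>j\<in>{..<n}. Y j -` A (Suc j) \<inter> space M) = (\<Prod>j\<in>{..<n}. prob (Y j -` A (Suc j) \<inter> space M))"
      using n AS by (intro indep_varsD_finite[OF Y]) auto
    also have "prob (X -` A 0 \<inter> space M) * \<dots>
        = (\<Prod>j\<in>{..n}. prob (case_nat X Y j -` A j \<inter> space M))"
      unfolding ins by (simp add: prod.reindex)
    finally show "prob (\<Inter>j\<in>{..n}. case_nat X Y j -` A j \<inter> space M)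
      = (\<Prod>j\<in>{..n}. prob (case_nat X Y j -` A j \<inter> space M))" .
  qed
  finally show ?thesis .
qed

text \<open>A bridge between densities over \<open>lborel\<close>, in which Brownian increments are
  described, and laws over \<open>borel\<close>, which determine and are determined by
  characteristic functions.\<close>

lemma (in prob_space) distributed_normal_iff_std:
  assumes "\<sigma> > 0" and "X \<in> borel_measurable M"
  shows "distributed M lborel X (normal_density 0 \<sigma>) \<longleftrightarrow>
    distr M borel (\<lambda>\<omega>. X \<omega> / \<sigma>) = std_normal_distribution"
proof -
  have "distributed M lborel X (normal_density 0 \<sigma>) \<longleftrightarrow>
      distributed M lborel (\<lambda>\<omega>. X \<omega> / \<sigma>) std_normal_density"
    using normal_standard_normal_convert[of \<sigma> X 0] assms by simp
  also have "\<dots> \<longleftrightarrow> distr M borel (\<lambda>\<omega>. X \<omega> / \<sigma>) = std_normal_distribution"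
  proof -
    have "distr M lborel (\<lambda>\<omega>. X \<omega> / \<sigma>) = distr M borel (\<lambda>\<omega>. X \<omega> / \<sigma>)"
      by (rule distr_cong) auto
    then show ?thesis using assms by (simp add: distributed_def)
  qed
  finally show ?thesis .
qed

lemma (in prob_space) char_distributed_normal:
  assumes X: "distributed M lborel X (normal_density 0 \<sigma>)" and \<sigma>: "\<sigma> > 0"
  shows "char (distr M borel X) u = complex_of_real (exp (- ((\<sigma> * u)\<^sup>2) / 2))"
proof -
  have [measurable]: "X \<in> borel_measurable M" using distributed_measurable[OF X] by simp
  have "char (distr M borel X) u = (CLINT \<omega>|M. iexp (u * X \<omega>))"
    by (simp add: char_def integral_distr)
  also have "\<dots> = (CLINT \<omega>|M. iexp ((\<sigma> * u) * (X \<omega> / \<sigma>)))"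
  proof -
    have "u * X \<omega> = (\<sigma> * u) * (X \<omega> / \<sigma>)" for \<omega> using \<sigma> by simp
    then show ?thesis by (simp only:)
  qed
  also have "\<dots> = char (distr M borel (\<lambda>\<omega>. X \<omega> / \<sigma>)) (\<sigma> * u)"
    using \<sigma> by (simp add: char_def integral_distr)
  also have "distr M borel (\<lambda>\<omega>. X \<omega> / \<sigma>) = std_normal_distribution"
    using X \<sigma> by (simp add: distributed_normal_iff_std)
  finally show ?thesis by (simp add: char_std_normal_distribution)
qed

section \<open>The process with its driving noise, and the law of a single value\<close>

locale ou_process = prob_space M for M :: "'a measure" +
  fixes Z W :: "real \<Rightarrow> 'a \<Rightarrow> real"
  assumes stationary: "stationary_process M Z"
    and continuous_paths: "\<And>\<omega>. \<omega> \<in> space M \<Longrightarrow> continuous_on {0..} (\<lambda>t. Z t \<omega>)"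
    and brownian: "brownian_motion M W"
    and solution: "ou_solution M W Z"
begin

lemma Z_measurable [measurable]: "t \<ge> 0 \<Longrightarrow> Z t \<in> borel_measurable M"
  using stationary by (auto simp: stationary_process_def)

lemma W_measurable [measurable]: "t \<ge> 0 \<Longrightarrow> W t \<in> borel_measurable M"
  using brownian by (auto simp: brownian_motion_def)

text \<open>Equality of path laws passes to every measurable functional of the path; it is applied
  to one coordinate and to the sum of two.\<close>

lemma stationary_distr:
  assumes f: "f \<in> measurable (PiM {0..} (\<lambda>_. borel)) N" and h: "h \<ge> 0"
  shows "distr M N (\<lambda>\<omega>. f (\<lambda>t\<in>{0..}. Z (t + h) \<omega>)) = distr M N (\<lambda>\<omega>. f (\<lambda>t\<in>{0..}. Z t \<omega>))"
proof -
  have m: "(\<lambda>\<omega>. \<lambda>t\<in>{0..}. Z (t + k) \<omega>) \<in> measurable M (PiM {0..} (\<lambda>_. borel))" if "k \<ge> 0" for k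
    using that by (intro measurable_restrict) auto
  have "distr M (\<Pi>\<^sub>M t\<in>{0..}. borel) (\<lambda>\<omega>. \<lambda>t\<in>{0..}. Z (t + h) \<omega>) =
        distr M (\<Pi>\<^sub>M t\<in>{0..}. borel) (\<lambda>\<omega>. \<lambda>t\<in>{0..}. Z t \<omega>)"
    using stationary h by (auto simp: stationary_process_def)
  from arg_cong[OF this, of "\<lambda>D. distr D N f"] show ?thesis
    using m[OF h] m[of 0] f by (simp add: distr_distr comp_def)
qed

lemma distr_Z: "t \<ge> 0 \<Longrightarrow> distr M borel (Z t) = distr M borel (Z 0)"
  using stationary_distr[of "\<lambda>f. f 0" borel t] by simp

definition noise :: "real \<Rightarrow> nat \<Rightarrow> nat \<Rightarrow> 'a \<Rightarrow> real" where
  "noise b n j \<omega> = euler_coeff (grid b n j) (grid b n (Suc j)) * sqrt 2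
     * (W (grid b n (Suc j)) \<omega> - W (grid b n j) \<omega>)"

lemma euler_sum_noise: "euler_sum (\<lambda>t. W t \<omega>) b n k = (\<Sum>j<k. noise b n j \<omega>)"
  by (simp add: euler_sum_def noise_def)

definition noise_var :: "real \<Rightarrow> nat \<Rightarrow> nat \<Rightarrow> real" where
  "noise_var b n j = exp (2 * grid b n (Suc j)) - exp (2 * grid b n j)"

lemma noise_var_pos: "b > 0 \<Longrightarrow> n > 0 \<Longrightarrow> noise_var b n j > 0"
  by (simp add: noise_var_def grid_Suc)

lemma sum_noise_var: "n > 0 \<Longrightarrow> (\<Sum>j<n. noise_var b n j) = exp (2 * b) - 1"
  using sum_lessThan_telescope[of "\<lambda>j. exp (2 * grid b n j)" n] by (simp add: noise_var_def)

lemma noise_distributed: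
  assumes b: "b > 0" and n: "n > 0"
  shows "distributed M lborel (noise b n j) (normal_density 0 (sqrt (noise_var b n j)))"
proof -
  let ?s = "grid b n j" and ?t = "grid b n (Suc j)"
  have st: "0 \<le> ?s" "?s < ?t" using b n by (auto simp: grid_nonneg grid_Suc)
  define c where "c = euler_coeff ?s ?t * sqrt 2"
  have c: "c > 0"
    using euler_coeff_bounds(3)[OF st(2)] exp_gt_zero[of ?s] unfolding c_def by (simp del: exp_gt_zero)
  have "distributed M lborel (\<lambda>\<omega>. W ?t \<omega> - W ?s \<omega>) (normal_density 0 (sqrt (?t - ?s)))"
    using brownian st by (auto simp: brownian_motion_def)
  then have "distributed M lborel (\<lambda>\<omega>. 0 + c * (W ?t \<omega> - W ?s \<omega>))
      (normal_density (0 + c * 0) (\<bar>c\<bar> * sqrt (?t - ?s)))"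
    using st c by (intro normal_density_affine) auto
  then have "distributed M lborel (noise b n j) (normal_density 0 (\<bar>c\<bar> * sqrt (?t - ?s)))"
    by (simp add: noise_def[abs_def] c_def)
  \<comment> \<open>This is what \<open>euler_coeff\<close> was chosen for: the step length
    cancels.\<close>
  moreover have "\<bar>c\<bar> * sqrt (?t - ?s) = sqrt (noise_var b n j)"
    using st c by (simp add: c_def euler_coeff_def noise_var_def real_sqrt_mult[symmetric] field_simps)
  ultimately show ?thesis by simp
qed

lemma noise_indep:
  assumes b: "b > 0" and n: "n > 0"
  shows "indep_vars (\<lambda>_. borel) (noise b n) {..<n}"
proof -
  have "mono (grid b n)"
    using b n by (auto simp: mono_def grid_def intro!: divide_right_mono mult_right_mono)
  then have "indep_vars (\<lambda>_. borel) (\<lambda>i \<omega>. W (grid b n (Suc i)) \<omega> - W (grid b n i) \<omega>) {..<n}"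
    using brownian unfolding brownian_motion_def by (auto simp: grid_0)
  from indep_vars_compose2[OF this, of "\<lambda>j x. euler_coeff (grid b n j) (grid b n (Suc j)) * sqrt 2 * x" "\<lambda>_. borel"]
  show ?thesis by (simp add: noise_def[abs_def])
qed

text \<open>Each noise term depends on two coordinates of the path of \<open>W\<close>, so events
  about the noise are preimages of sets \<open>C\<close> in the product space of paths. Independence
  of \<open>Z 0\<close> from the whole path then gives the product formula.\<close>

lemma indep_Z0_noise:
  assumes b: "b > 0" and n: "n > 0"
  shows "indep_vars (\<lambda>_. borel) (case_nat (Z 0) (noise b n)) {..n}"
proof (rule indep_vars_case_nat[OF _ noise_indep[OF b n] n])
  fix B :: "real set" and A :: "nat \<Rightarrow> real set"
  assume B: "B \<in> sets borel" and A: "\<And>j. j < n \<Longrightarrow> A j \<in> sets borel"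
  define g where "g j f = euler_coeff (grid b n j) (grid b n (Suc j)) * sqrt 2
     * (f (grid b n (Suc j)) - f (grid b n j))" for j and f :: "real \<Rightarrow> real"
  define C where "C = {f \<in> space (PiM {0..} (\<lambda>_. borel)). \<forall>j\<in>{..<n}. g j f \<in> A j}"
  have [measurable]: "g j \<in> borel_measurable (PiM {0..} (\<lambda>_. borel))" for j
    unfolding g_def using b
    by (intro borel_measurable_times borel_measurable_diff
        measurable_component_singleton borel_measurable_const) (auto simp: grid_nonneg)
  have "Measurable.pred (PiM {0..} (\<lambda>_. borel)) (\<lambda>f. g j f \<in> A j)" if "j \<in> {..<n}" for j
    using A[of j] that by (intro pred_sets2[of _ borel]) auto
  then have C: "C \<in> sets (PiM {0..} (\<lambda>_. borel))"
    unfolding C_def by (intro predE pred_intros_finite) auto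
  have eq: "(\<Inter>j\<in>{..<n}. noise b n j -` A j \<inter> space M) = (\<lambda>\<omega>. \<lambda>t\<in>{0..}. W t \<omega>) -` C \<inter> space M"
    using b n by (auto simp: C_def g_def noise_def space_PiM grid_nonneg)
  show "prob ((Z 0 -` B \<inter> space M) \<inter> (\<Inter>j\<in>{..<n}. noise b n j -` A j \<inter> space M))
      = prob (Z 0 -` B \<inter> space M) * prob (\<Inter>j\<in>{..<n}. noise b n j -` A j \<inter> space M)"
    unfolding eq using solution B C unfolding ou_solution_def by (intro indep_setD) auto
qed simp

lemma indep_Z0_euler_sum:
  assumes b: "b > 0" and n: "n > 0"
  shows "indep_var borel (Z 0) borel (\<lambda>\<omega>. euler_sum (\<lambda>t. W t \<omega>) b n n)"
proof -
  have "{..n} = insert 0 (Suc ` {..<n})"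
    using n by (simp add: lessThan_Suc_eq_insert_0 lessThan_Suc_atMost[symmetric])
  with indep_Z0_noise[OF b n]
  have "indep_vars (\<lambda>_. borel) (case_nat (Z 0) (noise b n)) (insert 0 (Suc ` {..<n}))" by simp
  from indep_vars_sum[OF _ _ this] show ?thesis
    by (simp add: sum.reindex euler_sum_noise)
qed

text \<open>The variances telescope, so the law is exact and the same for every
  \<open>n > 0\<close>.\<close>

lemma euler_sum_distributed:
  assumes b: "b > 0" and n: "n > 0"
  shows "distributed M lborel (\<lambda>\<omega>. euler_sum (\<lambda>t. W t \<omega>) b n n)
    (normal_density 0 (sqrt (exp (2 * b) - 1)))"
proof -
  have "distributed M lborel (\<lambda>\<omega>. \<Sum>j<n. noise b n j \<omega>)
      (normal_density (\<Sum>j<n. 0) (sqrt (\<Sum>j<n. (sqrt (noise_var b n j))\<^sup>2)))"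
    using n noise_distributed[OF b n] noise_indep[OF b n] noise_var_pos[OF b n]
    by (intro sum_indep_normal) auto
  then show ?thesis
    using sum_noise_var[OF n] noise_var_pos[OF b n] by (simp add: euler_sum_noise less_imp_le)
qed

lemma euler_sum_measurable [measurable]:
  "b > 0 \<Longrightarrow> k \<le> n \<Longrightarrow> (\<lambda>\<omega>. euler_sum (\<lambda>t. W t \<omega>) b n k) \<in> borel_measurable M"
  unfolding euler_sum_def by (auto intro!: borel_measurable_sum simp: grid_nonneg)

lemma AE_euler_sum_approx:
  assumes b: "b > 0"
  shows "AE \<omega> in M. \<forall>\<epsilon>>0. \<forall>\<^sub>F n in sequentially. \<forall>k\<le>n.
    \<bar>Z 0 \<omega> + euler_sum (\<lambda>t. W t \<omega>) b n k - exp (grid b n k) * Z (grid b n k) \<omega>\<bar> < \<epsilon>"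
proof -
  have "AE \<omega> in M. \<forall>t\<ge>0. Z t \<omega> = Z 0 \<omega> - integral {0..t} (\<lambda>s. Z s \<omega>) + sqrt 2 * W t \<omega>"
    using solution by (simp add: ou_solution_def)
  with AE_space show ?thesis
  proof eventually_elim
    case (elim \<omega>)
    show ?case
    proof (intro allI impI)
      fix \<epsilon> :: real assume "\<epsilon> > 0"
      show "\<forall>\<^sub>F n in sequentially. \<forall>k\<le>n.
        \<bar>Z 0 \<omega> + euler_sum (\<lambda>t. W t \<omega>) b n k - exp (grid b n k) * Z (grid b n k) \<omega>\<bar> < \<epsilon>"
        using elim(2) by (intro euler_sum_approx b continuous_paths elim(1) \<open>\<epsilon> > 0\<close>) blast
    qed
  qed
qed

lemma AE_euler_sum_tendsto:
  assumes b: "b > 0"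
  shows "AE \<omega> in M. (\<lambda>n. Z 0 \<omega> + euler_sum (\<lambda>t. W t \<omega>) b n n) \<longlonglongrightarrow> exp b * Z b \<omega>"
  using AE_euler_sum_approx[OF b]
proof eventually_elim
  case (elim \<omega>)
  show ?case
  proof (rule tendstoI)
    fix e :: real assume "e > 0"
    with elim have "\<forall>\<^sub>F n in sequentially. \<forall>k\<le>n.
      \<bar>Z 0 \<omega> + euler_sum (\<lambda>t. W t \<omega>) b n k - exp (grid b n k) * Z (grid b n k) \<omega>\<bar> < e"
      by blast
    with eventually_gt_at_top[of 0]
    show "\<forall>\<^sub>F n in sequentially. dist (Z 0 \<omega> + euler_sum (\<lambda>t. W t \<omega>) b n n) (exp b * Z b \<omega>) < e"
    proof eventually_elim
      case (elim n)
      from elim(2)[rule_format, of n] elim(1) show ?case by (simp add: dist_real_def)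
    qed
  qed
qed

text \<open>Almost surely \<open>exp b * Z b\<close> is the limit of \<open>Z 0\<close> plus an
  independent Gaussian of variance \<open>exp (2 * b) - 1\<close>. Dominated convergence passes to
  characteristic functions, and stationarity replaces the law of \<open>Z b\<close> by that of
  \<open>Z 0\<close>.\<close>

lemma char_Z0_recursion:
  assumes b: "b > 0"
  shows "char (distr M borel (Z 0)) v
    = char (distr M borel (Z 0)) (exp (- b) * v) * complex_of_real (exp (- ((1 - exp (- (2 * b))) * v\<^sup>2) / 2))"
proof -
  \<comment> \<open>Chosen so that \<open>u * exp b = v\<close>.\<close>
  define u where "u = exp (- b) * v"
  let ?S = "\<lambda>n \<omega>. Z 0 \<omega> + euler_sum (\<lambda>t. W t \<omega>) b n n"
  have [measurable]: "Z b \<in> borel_measurable M" using b by simp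
  have [measurable]: "(\<lambda>\<omega>. euler_sum (\<lambda>t. W t \<omega>) b n n) \<in> borel_measurable M" for n
    using b by simp
  have "(\<lambda>n. CLINT \<omega>|M. iexp (u * ?S n \<omega>)) \<longlonglongrightarrow> (CLINT \<omega>|M. iexp (u * (exp b * Z b \<omega>)))"
  proof (rule integral_dominated_convergence[where w="\<lambda>_. 1"])
    show "AE \<omega> in M. (\<lambda>n. iexp (u * ?S n \<omega>)) \<longlonglongrightarrow> iexp (u * (exp b * Z b \<omega>))"
      using AE_euler_sum_tendsto[OF b]
      by eventually_elim (intro isCont_tendsto_compose[where g=iexp, OF isCont_iexp] tendsto_mult_left)
  qed auto
  moreover have "(CLINT \<omega>|M. iexp (u * ?S n \<omega>)) = char (distr M borel (Z 0)) u
      * complex_of_real (exp (- ((sqrt (exp (2 * b) - 1) * u)\<^sup>2) / 2))" if n: "n > 0" for n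
  proof -
    have "(CLINT \<omega>|M. iexp (u * ?S n \<omega>)) = char (distr M borel (?S n)) u"
      by (simp add: char_def integral_distr)
    also have "\<dots> = char (distr M borel (Z 0)) u
        * char (distr M borel (\<lambda>\<omega>. euler_sum (\<lambda>t. W t \<omega>) b n n)) u"
      by (rule char_distr_add[OF indep_Z0_euler_sum[OF b n]])
    also have "char (distr M borel (\<lambda>\<omega>. euler_sum (\<lambda>t. W t \<omega>) b n n)) u
        = complex_of_real (exp (- ((sqrt (exp (2 * b) - 1) * u)\<^sup>2) / 2))"
      using b by (intro char_distributed_normal euler_sum_distributed n) auto
    finally show ?thesis .
  qed
  \<comment> \<open>For \<open>n > 0\<close> the integral does not depend on
    \<open>n\<close>.\<close>
  then have "(\<lambda>n. CLINT \<omega>|M. iexp (u * ?S n \<omega>)) \<longlonglongrightarrow> char (distr M borel (Z 0)) u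
      * complex_of_real (exp (- ((sqrt (exp (2 * b) - 1) * u)\<^sup>2) / 2))"
    by (intro tendsto_eventually eventually_mono[OF eventually_gt_at_top[of 0]]) auto
  ultimately have "(CLINT \<omega>|M. iexp (u * (exp b * Z b \<omega>))) = char (distr M borel (Z 0)) u
      * complex_of_real (exp (- ((sqrt (exp (2 * b) - 1) * u)\<^sup>2) / 2))"
    by (rule LIMSEQ_unique)
  also have "(sqrt (exp (2 * b) - 1) * u)\<^sup>2 = (1 - exp (- (2 * b))) * v\<^sup>2"
    using b by (simp add: u_def power_mult_distrib exp_double[symmetric] algebra_simps exp_add[symmetric])
  also have "(CLINT \<omega>|M. iexp (u * (exp b * Z b \<omega>))) = (CLINT \<omega>|M. iexp (v * Z b \<omega>))"
  proof -
    have "u * (exp b * x) = v * x" for x by (simp add: u_def exp_minus)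
    then show ?thesis by (simp only:)
  qed
  also have "\<dots> = char (distr M borel (Z b)) v"
    by (simp add: char_def integral_distr)
  also have "distr M borel (Z b) = distr M borel (Z 0)" using b by (intro distr_Z) simp
  finally show ?thesis by (simp add: u_def)
qed

text \<open>Let \<open>b\<close> grow in the recursion at fixed \<open>v\<close>: the first factor
  tends to the characteristic function at \<open>0\<close>, which is \<open>1\<close>, and the
  second to \<open>exp (- v\<^sup>2 / 2)\<close>. Levy's uniqueness theorem identifies the
  law.\<close>

lemma distr_Z_std_normal:
  assumes "t \<ge> 0"
  shows "distr M borel (Z t) = std_normal_distribution"
proof -
  let ?D = "distr M borel (Z 0)"
  interpret D: real_distribution ?D by simp
  have "char ?D v = char std_normal_distribution v" for v
  proof -
    have e: "(\<lambda>m. exp (- real (Suc m))) \<longlonglongrightarrow> 0"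
    proof -
      have "(\<lambda>m. exp (- 1 :: real) ^ m) \<longlonglongrightarrow> 0" by (rule LIMSEQ_power_zero) simp
      then have "(\<lambda>m. exp (- real m)) \<longlonglongrightarrow> 0" by (simp add: exp_of_nat_mult[symmetric])
      then show ?thesis by (rule LIMSEQ_Suc)
    qed
    have e2: "exp (- (2 * real (Suc m))) = (exp (- real (Suc m)))\<^sup>2" for m
      using exp_double[of "- real (Suc m)"] by simp
    have "(\<lambda>m. char ?D (exp (- real (Suc m)) * v)
        * complex_of_real (exp (- ((1 - exp (- (2 * real (Suc m)))) * v\<^sup>2) / 2)))
      \<longlonglongrightarrow> char ?D (0 * v) * complex_of_real (exp (- ((1 - 0\<^sup>2) * v\<^sup>2) / 2))"
      unfolding e2
      by (intro tendsto_mult tendsto_of_real tendsto_exp tendsto_divide tendsto_minus tendsto_diff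
          tendsto_power tendsto_const e isCont_tendsto_compose[OF D.isCont_char]) simp
    moreover have "char ?D (exp (- real (Suc m)) * v)
        * complex_of_real (exp (- ((1 - exp (- (2 * real (Suc m)))) * v\<^sup>2) / 2)) = char ?D v" for m
      using char_Z0_recursion[of "real (Suc m)" v] by (simp only: of_nat_0_less_iff zero_less_Suc)
    \<comment> \<open>By the recursion the sequence is constantly \<open>char ?D v\<close>.\<close>
    ultimately have "(\<lambda>m::nat. char ?D v) \<longlonglongrightarrow> complex_of_real (exp (- (v\<^sup>2) / 2))"
      by (simp add: D.char_zero)
    then show ?thesis
      by (simp add: LIMSEQ_const_iff char_std_normal_distribution)
  qed
  then have "?D = std_normal_distribution"
    by (intro Levy_uniqueness D.real_distribution_axioms real_dist_normal_dist) auto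
  with distr_Z[OF assms] show ?thesis by simp
qed

end

section \<open>Pairs and suprema\<close>

context ou_process begin

lemma Z_tail: "t \<ge> 0 \<Longrightarrow> prob {\<omega> \<in> space M. Z t \<omega> \<ge> z} = std_normal_tail z"
proof -
  assume t: "t \<ge> 0"
  have "std_normal_tail z = measure (distr M borel (Z t)) {z..}"
    by (simp add: distr_Z_std_normal[OF t] std_normal_tail_eq)
  also have "\<dots> = prob (Z t -` {z..} \<inter> space M)" using t by (intro measure_distr) auto
  also have "Z t -` {z..} \<inter> space M = {\<omega> \<in> space M. Z t \<omega> \<ge> z}" by auto
  finally show ?thesis by simp
qed

text \<open>Used with \<open>\<alpha> = 1 + exp (- h)\<close> and \<open>\<beta> = exp (- h)\<close>
  to approximate \<open>Z 0 + Z h\<close>, and with \<open>\<alpha> = \<beta> = 1\<close> for the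
  full sum in the maximal inequality.\<close>

lemma Z0_euler_sum_distributed:
  assumes b: "b > 0" and n: "n > 0" and \<alpha>: "\<alpha> > 0" and \<beta>: "\<beta> > 0"
  shows "distributed M lborel (\<lambda>\<omega>. \<alpha> * Z 0 \<omega> + \<beta> * euler_sum (\<lambda>t. W t \<omega>) b n n)
    (normal_density 0 (sqrt (\<alpha>\<^sup>2 + \<beta>\<^sup>2 * (exp (2 * b) - 1))))"
proof -
  have e: "exp (2 * b) - 1 > 0" using b by simp
  have "distr M borel (\<lambda>\<omega>. Z 0 \<omega> / 1) = std_normal_distribution"
    using distr_Z_std_normal[of 0] by simp
  then have "distributed M lborel (Z 0) (normal_density 0 1)"
    by (subst distributed_normal_iff_std) auto
  then have 1: "distributed M lborel (\<lambda>\<omega>. 0 + \<alpha> * Z 0 \<omega>) (normal_density (0 + \<alpha> * 0) (\<bar>\<alpha>\<bar> * 1))"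
    using \<alpha> by (intro normal_density_affine) auto
  have 2: "distributed M lborel (\<lambda>\<omega>. 0 + \<beta> * euler_sum (\<lambda>t. W t \<omega>) b n n)
      (normal_density (0 + \<beta> * 0) (\<bar>\<beta>\<bar> * sqrt (exp (2 * b) - 1)))"
    using \<beta> e by (intro normal_density_affine euler_sum_distributed b n) auto
  have "indep_var borel ((\<lambda>x. \<alpha> * x) \<circ> Z 0) borel ((\<lambda>x. \<beta> * x) \<circ> (\<lambda>\<omega>. euler_sum (\<lambda>t. W t \<omega>) b n n))"
    by (intro indep_var_compose[OF indep_Z0_euler_sum[OF b n]]) auto
  then have "distributed M lborel (\<lambda>\<omega>. \<alpha> * Z 0 \<omega> + \<beta> * euler_sum (\<lambda>t. W t \<omega>) b n n)
     (normal_density (0 + 0) (sqrt (\<alpha>\<^sup>2 + (\<beta> * sqrt (exp (2 * b) - 1))\<^sup>2)))"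
    using 1 2 \<alpha> \<beta> e by (intro add_indep_normal) (auto simp: comp_def)
  then show ?thesis using e by (simp add: power_mult_distrib)
qed

section \<open>Sums of two values of the process\<close>

text \<open>\<open>Z h\<close> is the almost sure limit of \<open>exp (- h)\<close> times
  \<open>Z 0\<close> plus the Euler sum, so \<open>Z 0 + Z h\<close> is a limit of Gaussians that
  all have variance \<open>2 + 2 * exp (- h)\<close>.\<close>

lemma Z0_plus_Z_tail_le:
  assumes h: "h > 0"
  shows "prob {\<omega> \<in> space M. Z 0 \<omega> + Z h \<omega> \<ge> x} \<le> std_normal_tail (x / sqrt (2 + 2 * exp (- h)))"
proof -
  let ?\<sigma> = "sqrt (2 + 2 * exp (- h))"
  have \<sigma>: "?\<sigma> > 0" by (simp add: add_pos_pos)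
  have [measurable]: "Z h \<in> borel_measurable M" using h by simp
  have [measurable]: "(\<lambda>\<omega>. euler_sum (\<lambda>t. W t \<omega>) h n n) \<in> borel_measurable M" for n
    using h by simp
  have "prob {\<omega> \<in> space M. Z 0 \<omega> + Z h \<omega> \<ge> x} \<le> 1 * std_normal_tail (x / ?\<sigma>)"
  proof (rule le_std_normal_tailI[OF \<sigma>])
    fix \<epsilon> :: real assume \<epsilon>: "\<epsilon> > 0"
    \<comment> \<open>Used at \<open>Suc n\<close>, because on the empty grid the variance would be
      a different one.\<close>
    let ?X = "\<lambda>n \<omega>. (1 + exp (- h)) * Z 0 \<omega> + exp (- h) * euler_sum (\<lambda>t. W t \<omega>) h n n"
    have "prob {\<omega> \<in> space M. Z 0 \<omega> + Z h \<omega> \<ge> x} \<le> std_normal_tail ((x - \<epsilon>) / ?\<sigma>)"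
    proof (rule prob_le_if_eventually)
      show "AE \<omega> in M. \<omega> \<in> {\<omega> \<in> space M. Z 0 \<omega> + Z h \<omega> \<ge> x} \<longrightarrow>
        (\<forall>\<^sub>F n in sequentially. \<omega> \<in> {\<omega> \<in> space M. ?X (Suc n) \<omega> \<ge> x - \<epsilon>})"
        using AE_euler_sum_tendsto[OF h]
      proof eventually_elim
        case (elim \<omega>)
        note lim = tendsto_add[OF tendsto_const[of "Z 0 \<omega>"] tendsto_mult_left[OF elim, of "exp (- h)"]]
        have "(\<lambda>n. ?X n \<omega>) \<longlonglongrightarrow> Z 0 \<omega> + Z h \<omega>"
        proof -
          have "exp (- h) * (exp h * y) = y" for y by (simp add: exp_minus)
          with lim show ?thesis by (simp add: distrib_left distrib_right add.assoc)
        qed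
        then have "(\<lambda>n. ?X (Suc n) \<omega>) \<longlonglongrightarrow> Z 0 \<omega> + Z h \<omega>" by (rule LIMSEQ_Suc)
        then show ?case
          using \<epsilon> by (auto dest!: order_tendstoD(1)[of _ _ _ "x - \<epsilon>"] elim!: eventually_mono)
      qed
      show "prob {\<omega> \<in> space M. ?X (Suc n) \<omega> \<ge> x - \<epsilon>} \<le> std_normal_tail ((x - \<epsilon>) / ?\<sigma>)" for n
      proof -
        have "(1 + exp (- h))\<^sup>2 + (exp (- h))\<^sup>2 * (exp (2 * h) - 1) = 2 + 2 * exp (- h)"
          by (simp add: power2_eq_square algebra_simps exp_add[symmetric])
        with Z0_euler_sum_distributed[OF h, of "Suc n" "1 + exp (- h)" "exp (- h)"]
        have "distributed M lborel (?X (Suc n)) (normal_density 0 ?\<sigma>)"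
          by (simp add: add_pos_pos)
        from distributed_normal_tail[OF this \<sigma>, of "x - \<epsilon>"] show ?thesis by simp
      qed
    qed measurable
    then show "prob {\<omega> \<in> space M. Z 0 \<omega> + Z h \<omega> \<ge> x} \<le> 1 * std_normal_tail ((x - \<epsilon>) / ?\<sigma>)"
      by simp
  qed
  then show ?thesis by simp
qed

text \<open>Stationarity moves the earlier time to \<open>0\<close>.\<close>

lemma Z_plus_Z_tail_le:
  assumes s: "s \<ge> 0" "t \<ge> 0" "s \<noteq> t"
  shows "prob {\<omega> \<in> space M. Z s \<omega> + Z t \<omega> \<ge> x} \<le> std_normal_tail (x / sqrt (2 + 2 * exp (- \<bar>s - t\<bar>)))"
proof -
  define a h where "a = min s t" and "h = \<bar>s - t\<bar>"
  have ah: "a \<ge> 0" "h > 0" using s by (auto simp: a_def h_def)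
  have "prob {\<omega> \<in> space M. Z s \<omega> + Z t \<omega> \<ge> x} = prob {\<omega> \<in> space M. Z a \<omega> + Z (h + a) \<omega> \<ge> x}"
    by (cases "s \<le> t") (simp_all add: a_def h_def add.commute)
  also have "\<dots> = measure (distr M borel (\<lambda>\<omega>. Z a \<omega> + Z (h + a) \<omega>)) {x..}"
    using ah by (subst measure_distr) (auto intro!: arg_cong[where f=prob])
  also have "distr M borel (\<lambda>\<omega>. Z a \<omega> + Z (h + a) \<omega>) = distr M borel (\<lambda>\<omega>. Z 0 \<omega> + Z h \<omega>)"
  proof -
    have "(\<lambda>f. f 0 + f h :: real) \<in> borel_measurable (PiM {0..} (\<lambda>_. borel))"
      using ah by (intro borel_measurable_add measurable_component_singleton) auto
    from stationary_distr[OF this ah(1)] show ?thesis using ah by simp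
  qed
  also have "measure \<dots> {x..} = prob {\<omega> \<in> space M. Z 0 \<omega> + Z h \<omega> \<ge> x}"
    using ah by (subst measure_distr) (auto intro!: arg_cong[where f=prob])
  also have "\<dots> \<le> std_normal_tail (x / sqrt (2 + 2 * exp (- h)))"
    by (rule Z0_plus_Z_tail_le[OF ah(2)])
  finally show ?thesis by (simp add: h_def)
qed

section \<open>Suprema over compact sets of times\<close>

text \<open>The uncountable union is replaced by one over a countable dense set \<open>D\<close>. As
  \<open>D\<close> may miss the maximum, thresholds slightly below \<open>z\<close> are used;
  compactness of \<open>K\<close> recovers a time where \<open>z\<close> itself is reached.\<close>

lemma ex_Z_ge_measurable:
  assumes K: "compact K" "K \<subseteq> {0..}"
  shows "{\<omega> \<in> space M. \<exists>t\<in>K. z \<le> Z t \<omega>} \<in> events"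
proof -
  obtain D where D: "countable D" "D \<subseteq> K" "K \<subseteq> closure D" by (rule separable)
  have cont: "continuous_on K (\<lambda>t. Z t \<omega>)" if "\<omega> \<in> space M" for \<omega>
    using continuous_paths[OF that] K(2) by (rule continuous_on_subset)
  have iff: "(\<exists>t\<in>K. z \<le> Z t \<omega>) \<longleftrightarrow> (\<forall>m. \<exists>t\<in>D. z - inverse (real (Suc m)) < Z t \<omega>)"
    if \<omega>: "\<omega> \<in> space M" for \<omega>
  proof
    assume "\<exists>t\<in>K. z \<le> Z t \<omega>"
    then obtain t where t: "t \<in> K" "z \<le> Z t \<omega>" by auto
    show "\<forall>m. \<exists>t\<in>D. z - inverse (real (Suc m)) < Z t \<omega>"
    proof
      fix m
      have "inverse (real (Suc m)) > 0" by simp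
      with cont[OF \<omega>] t(1) obtain d where d: "d > 0"
        "\<And>s. s \<in> K \<Longrightarrow> dist s t < d \<Longrightarrow> dist (Z s \<omega>) (Z t \<omega>) < inverse (real (Suc m))"
        unfolding continuous_on_iff by metis
      from t(1) D(3) d(1) obtain s where "s \<in> D" "dist s t < d"
        by (metis closure_approachable subsetD)
      with d(2)[of s] D(2) t(2) show "\<exists>t\<in>D. z - inverse (real (Suc m)) < Z t \<omega>"
        by (intro bexI[of _ s]) (auto simp: dist_real_def)
    qed
  next
    assume *: "\<forall>m. \<exists>t\<in>D. z - inverse (real (Suc m)) < Z t \<omega>"
    with D(2) have "K \<noteq> {}" by blast
    from continuous_attains_sup[OF K(1) this cont[OF \<omega>]]
    obtain t where t: "t \<in> K" "\<And>s. s \<in> K \<Longrightarrow> Z s \<omega> \<le> Z t \<omega>" by auto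
    have "z - inverse (real (Suc m)) \<le> Z t \<omega>" for m
      using * t(2) D(2) by (meson less_imp_le order_trans subsetD)
    moreover have "(\<lambda>m. z - inverse (real (Suc m))) \<longlonglongrightarrow> z - 0"
      by (intro tendsto_intros LIMSEQ_inverse_real_of_nat)
    ultimately have "z \<le> Z t \<omega>" by (intro LIMSEQ_le_const2) auto
    then show "\<exists>t\<in>K. z \<le> Z t \<omega>" using t by auto
  qed
  have "{\<omega> \<in> space M. \<exists>t\<in>K. z \<le> Z t \<omega>}
    = (\<Inter>m. \<Union>t\<in>D. {\<omega> \<in> space M. z - inverse (real (Suc m)) < Z t \<omega>})"
    using iff by auto
  also have "\<dots> \<in> events"
  proof -
    have "{\<omega> \<in> space M. z - inverse (real (Suc m)) < Z t \<omega>} \<in> events" if "t \<in> D" for m t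
    proof -
      have [measurable]: "Z t \<in> borel_measurable M" using that D(2) K(2) by auto
      show ?thesis by measurable
    qed
    then have "(\<Union>t\<in>D. {\<omega> \<in> space M. z - inverse (real (Suc m)) < Z t \<omega>}) \<in> events" for m
      using D(1) by (intro sets.countable_UN') auto
    then show ?thesis by (intro sets.countable_INT) auto
  qed
  finally show ?thesis .
qed

lemma SUP_Z_ge_iff:
  assumes K: "compact K" "K \<noteq> {}" "K \<subseteq> {0..}" and \<omega>: "\<omega> \<in> space M"
  shows "z \<le> (SUP t\<in>K. Z t \<omega>) \<longleftrightarrow> (\<exists>t\<in>K. z \<le> Z t \<omega>)"
proof -
  have cont: "continuous_on K (\<lambda>t. Z t \<omega>)"
    using continuous_paths[OF \<omega>] K(3) by (rule continuous_on_subset)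
  from continuous_attains_sup[OF K(1,2) cont]
  obtain t where t: "t \<in> K" "\<And>s. s \<in> K \<Longrightarrow> Z s \<omega> \<le> Z t \<omega>" by auto
  then have "(SUP t\<in>K. Z t \<omega>) = Z t \<omega>" by (intro cSup_eq_maximum) auto
  with t show ?thesis by (metis order_trans)
qed

text \<open>With \<open>Z 0\<close> as summand number \<open>0\<close>, the partial sums are the
  Euler approximations of \<open>exp t * Z t\<close>, and the full sum has standard deviation
  exactly \<open>exp b\<close>.\<close>

lemma euler_maximal_inequality:
  assumes b: "b > 0" and n: "n > 0"
  shows "prob {\<omega> \<in> space M. \<exists>k\<le>n. x \<le> Z 0 \<omega> + euler_sum (\<lambda>t. W t \<omega>) b n k}
    \<le> 2 * std_normal_tail (x / exp b)"
proof -
  let ?X = "case_nat (Z 0) (noise b n)"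
  have sum: "(\<Sum>i\<le>k. ?X i \<omega>) = Z 0 \<omega> + euler_sum (\<lambda>t. W t \<omega>) b n k" for k \<omega>
    by (simp add: sum.atMost_shift euler_sum_noise)
  have "prob {\<omega> \<in> space M. \<exists>k\<le>n. x \<le> (\<Sum>i\<le>k. ?X i \<omega>)}
      \<le> 2 * prob {\<omega> \<in> space M. x \<le> (\<Sum>i\<le>n. ?X i \<omega>)}"
  proof (rule levy_maximal_inequality[OF indep_Z0_noise[OF b n]])
    fix k assume k: "k \<le> n"
    show "1 / 2 \<le> prob {\<omega> \<in> space M. 0 \<le> (\<Sum>i\<in>{k<..n}. ?X i \<omega>)}"
    proof (cases "k = n")
      case True
      \<comment> \<open>The remaining sum is empty, so the event is the whole space.\<close>
      then show ?thesis by (simp add: prob_space)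
    next
      case False
      \<comment> \<open>Summand \<open>i\<close> of \<open>?X\<close> is
        \<open>noise b n (i - 1)\<close>; the case \<open>i = 0\<close> is excluded by
        \<open>i > k\<close>.\<close>
      let ?s = "\<lambda>i. sqrt (noise_var b n (i - 1))"
      have "distributed M lborel (\<lambda>\<omega>. \<Sum>i\<in>{k<..n}. ?X i \<omega>)
          (normal_density (\<Sum>i\<in>{k<..n}. 0) (sqrt (\<Sum>i\<in>{k<..n}. (?s i)\<^sup>2)))"
      proof (rule sum_indep_normal)
        show "indep_vars (\<lambda>_. borel) ?X {k<..n}"
          by (rule indep_vars_subset[OF indep_Z0_noise[OF b n]]) auto
        show "distributed M lborel (?X i) (normal_density 0 (?s i))" if "i \<in> {k<..n}" for i
          using that noise_distributed[OF b n, of "i - 1"] by (cases i) auto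
      qed (use k False noise_var_pos[OF b n] in auto)
      moreover have "(\<Sum>i\<in>{k<..n}. (?s i)\<^sup>2) > 0"
        using k False noise_var_pos[OF b n] by (intro sum_pos) (auto simp: less_imp_neq[symmetric])
      ultimately have "prob {\<omega> \<in> space M. 0 \<le> (\<Sum>i\<in>{k<..n}. ?X i \<omega>)} = std_normal_tail 0"
        using distributed_normal_tail[where x = 0] by simp
      then show ?thesis using half_le_std_normal_tail_0 by simp
    qed
  qed
  also have "prob {\<omega> \<in> space M. x \<le> (\<Sum>i\<le>n. ?X i \<omega>)} = std_normal_tail (x / exp b)"
  proof -
    have "sqrt (1\<^sup>2 + 1\<^sup>2 * (exp (2 * b) - 1)) = exp b" by (simp add: exp_double)
    with Z0_euler_sum_distributed[OF b n, of 1 1]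
    have "distributed M lborel (\<lambda>\<omega>. \<Sum>i\<le>n. ?X i \<omega>) (normal_density 0 (exp b))"
      unfolding sum by simp
    then show ?thesis by (rule distributed_normal_tail) simp
  qed
  finally show ?thesis unfolding sum .
qed

text \<open>On this event \<open>exp t * Z t\<close> reaches \<open>exp a * z\<close> within
  \<open>{0..b}\<close>, so up to \<open>\<epsilon>\<close> some Euler partial sum does. The maximal
  inequality compares this with the full sum, whose standard deviation is
  \<open>exp b\<close>.\<close>

lemma prob_ex_Z_ge_le:
  assumes a: "0 \<le> a" "a < b" and z: "z > 0"
  shows "prob {\<omega> \<in> space M. \<exists>t\<in>{a..b}. z \<le> Z t \<omega>} \<le> 2 * std_normal_tail (exp (a - b) * z)"
proof -
  have b: "b > 0" using a by simp
  have "prob {\<omega> \<in> space M. \<exists>t\<in>{a..b}. z \<le> Z t \<omega>} \<le> 2 * std_normal_tail ((exp a * z) / exp b)"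
  proof (rule le_std_normal_tailI)
    fix \<epsilon> :: real assume \<epsilon>: "\<epsilon> > 0"
    let ?S = "\<lambda>n k \<omega>. Z 0 \<omega> + euler_sum (\<lambda>t. W t \<omega>) b n k"
    show "prob {\<omega> \<in> space M. \<exists>t\<in>{a..b}. z \<le> Z t \<omega>} \<le> 2 * std_normal_tail ((exp a * z - \<epsilon>) / exp b)"
    proof (rule prob_le_if_eventually)
      show "{\<omega> \<in> space M. \<exists>t\<in>{a..b}. z \<le> Z t \<omega>} \<in> events"
        using a by (intro ex_Z_ge_measurable) auto
      show "{\<omega> \<in> space M. \<exists>k\<le>Suc n. exp a * z - \<epsilon> \<le> ?S (Suc n) k \<omega>} \<in> events" for n
      proof -
        have [measurable]: "?S (Suc n) k \<in> borel_measurable M" if "k \<in> {..Suc n}" for k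
          using that b by (intro borel_measurable_add euler_sum_measurable) auto
        have "Measurable.pred M (\<lambda>\<omega>. \<exists>k\<in>{..Suc n}. exp a * z - \<epsilon> \<le> ?S (Suc n) k \<omega>)"
          by (intro pred_intros_finite) measurable
        then show ?thesis by (simp add: pred_def Bex_def)
      qed
      show "prob {\<omega> \<in> space M. \<exists>k\<le>Suc n. exp a * z - \<epsilon> \<le> ?S (Suc n) k \<omega>}
          \<le> 2 * std_normal_tail ((exp a * z - \<epsilon>) / exp b)" for n
        by (rule euler_maximal_inequality[OF b]) simp
      show "AE \<omega> in M. \<omega> \<in> {\<omega> \<in> space M. \<exists>t\<in>{a..b}. z \<le> Z t \<omega>} \<longrightarrow> (\<forall>\<^sub>F n in sequentially.
          \<omega> \<in> {\<omega> \<in> space M. \<exists>k\<le>Suc n. exp a * z - \<epsilon> \<le> ?S (Suc n) k \<omega>})"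
        using AE_euler_sum_approx[OF b]
      proof (eventually_elim, intro impI)
        fix \<omega>
        assume approx: "\<forall>\<epsilon>>0. \<forall>\<^sub>F n in sequentially. \<forall>k\<le>n.
            \<bar>?S n k \<omega> - exp (grid b n k) * Z (grid b n k) \<omega>\<bar> < \<epsilon>"
          and "\<omega> \<in> {\<omega> \<in> space M. \<exists>t\<in>{a..b}. z \<le> Z t \<omega>}"
        then obtain t where \<omega>: "\<omega> \<in> space M" and t: "a \<le> t" "t \<le> b" "z \<le> Z t \<omega>" by auto
        have "continuous_on {0..} (\<lambda>s. exp s * Z s \<omega>)"
          by (intro continuous_intros continuous_paths \<omega>)
        moreover have "t \<in> {0..}" "\<epsilon> / 2 > 0" using a t \<epsilon> by auto
        ultimately obtain d where d: "d > 0"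
          "\<And>s. s \<in> {0..} \<Longrightarrow> dist s t < d \<Longrightarrow> dist (exp s * Z s \<omega>) (exp t * Z t \<omega>) < \<epsilon> / 2"
          unfolding continuous_on_iff by metis
        \<comment> \<open>As \<open>z\<close> is positive, passing from \<open>exp t\<close> down to
          \<open>exp a\<close> lowers the bound.\<close>
        have Zt: "exp a * z \<le> exp t * Z t \<omega>" using t z by (intro mult_mono) auto
        have "\<forall>\<^sub>F n in sequentially. b / real n < d"
          using lim_const_over_n d(1) by (rule order_tendstoD)
        moreover have "\<forall>\<^sub>F n in sequentially. \<forall>k\<le>n.
            \<bar>?S n k \<omega> - exp (grid b n k) * Z (grid b n k) \<omega>\<bar> < \<epsilon> / 2"
          using approx \<epsilon> by (meson half_gt_zero)
        ultimately have "\<forall>\<^sub>F n in sequentially. \<exists>k\<le>n. exp a * z - \<epsilon> \<le> ?S n k \<omega>"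
          using eventually_gt_at_top[of 0]
        proof eventually_elim
          fix n :: nat
          assume n: "b / real n < d" "n > 0"
            and S: "\<forall>k\<le>n. \<bar>?S n k \<omega> - exp (grid b n k) * Z (grid b n k) \<omega>\<bar> < \<epsilon> / 2"
          \<comment> \<open>The first grid point not before \<open>t\<close>; it is less than one
            mesh away, and \<open>t \<le> b\<close> gives \<open>k \<le> n\<close>. Continuity and
            approximation cost \<open>\<epsilon> / 2\<close> each.\<close>
          define k where "k = nat \<lceil>t * real n / b\<rceil>"
          have k: "t * real n / b \<le> real k" "real k < t * real n / b + 1"
            using a t b ceiling_correct[of "t * real n / b"] by (auto simp: k_def of_nat_nat)
          have "t * real n / b \<le> real n"
            using t b mult_right_mono[of t b "real n"] by (simp add: field_simps)
          then have "k \<le> n" unfolding k_def by (simp add: ceiling_le_iff nat_le_iff)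
          moreover have "t \<le> grid b n k" "grid b n k < t + b / real n"
            using k b n by (auto simp: grid_def field_simps)
          then have "grid b n k \<in> {0..}" "dist (grid b n k) t < d"
            using a t n by (auto simp: dist_real_def)
          from d(2)[OF this] have "exp t * Z t \<omega> - \<epsilon> / 2 \<le> exp (grid b n k) * Z (grid b n k) \<omega>"
            unfolding dist_real_def abs_less_iff by linarith
          ultimately show "\<exists>k\<le>n. exp a * z - \<epsilon> \<le> ?S n k \<omega>"
            using S[rule_format, of k] Zt unfolding abs_less_iff by (intro exI[of _ k]) linarith
        qed
        then have "\<forall>\<^sub>F n in sequentially. \<exists>k\<le>Suc n. exp a * z - \<epsilon> \<le> ?S (Suc n) k \<omega>"
          by (rule eventually_sequentially_Suc[THEN iffD2])
        then show "\<forall>\<^sub>F n in sequentially.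
            \<omega> \<in> {\<omega> \<in> space M. \<exists>k\<le>Suc n. exp a * z - \<epsilon> \<le> ?S (Suc n) k \<omega>}"
          using \<omega> by simp
      qed
    qed
  qed simp
  then show ?thesis by (simp add: exp_diff)
qed

end

section \<open>Packings and the second moment method\<close>

text \<open>Two points in one cell of length \<open>\<epsilon>\<close> are closer than
  \<open>\<epsilon>\<close>, and the unit interval meets at most
  \<open>\<lfloor>1 / \<epsilon>\<rfloor> + 1\<close> cells. The injectivity itself is used again
  for the geometric series in the lower bound.\<close>

lemma packing_card_le:
  fixes x :: "nat \<Rightarrow> real"
  assumes \<epsilon>: "\<epsilon> > 0" and x: "\<And>i. i \<in> {1..k} \<Longrightarrow> x i \<in> {0..1}"
    and sep: "\<And>i j. i \<in> {1..k} \<Longrightarrow> j \<in> {1..k} \<Longrightarrow> i \<noteq> j \<Longrightarrow> \<epsilon> \<le> \<bar>x i - x j\<bar>"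
  shows "inj_on (\<lambda>i. \<lfloor>x i / \<epsilon>\<rfloor>) {1..k}" "k \<le> nat (\<lfloor>1 / \<epsilon>\<rfloor> + 1)"
proof -
  show inj: "inj_on (\<lambda>i. \<lfloor>x i / \<epsilon>\<rfloor>) {1..k}"
  proof (rule inj_onI, rule ccontr)
    fix i j assume ij: "i \<in> {1..k}" "j \<in> {1..k}" "\<lfloor>x i / \<epsilon>\<rfloor> = \<lfloor>x j / \<epsilon>\<rfloor>" "i \<noteq> j"
    have "\<bar>x i / \<epsilon> - x j / \<epsilon>\<bar> < 1"
      using ij(3) floor_correct[of "x i / \<epsilon>"] floor_correct[of "x j / \<epsilon>"] by linarith
    then have "\<bar>x i - x j\<bar> < \<epsilon>"
      using \<epsilon> by (simp add: diff_divide_distrib[symmetric] abs_divide)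
    with sep[OF ij(1,2,4)] show False by simp
  qed
  have "(\<lambda>i. \<lfloor>x i / \<epsilon>\<rfloor>) ` {1..k} \<subseteq> {0..\<lfloor>1 / \<epsilon>\<rfloor>}"
    using x \<epsilon> by (auto intro!: floor_mono divide_right_mono)
  from card_inj_on_le[OF inj this] show "k \<le> nat (\<lfloor>1 / \<epsilon>\<rfloor> + 1)" by simp
qed

text \<open>Boundedness of the packing sizes makes \<open>GREATEST\<close> attained, and maximality
  turns the packing into a cover.\<close>

lemma packing_number_attained:
  assumes E: "E \<subseteq> {0..1}" and \<epsilon>: "\<epsilon> > 0"
  obtains x :: "nat \<Rightarrow> real" where "\<And>i. i \<in> {1..packing_number E \<epsilon>} \<Longrightarrow> x i \<in> E"
    and "\<And>i j. i \<in> {1..packing_number E \<epsilon>} \<Longrightarrow> j \<in> {1..packing_number E \<epsilon>} \<Longrightarrow> i \<noteq> j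
      \<Longrightarrow> \<epsilon> \<le> \<bar>x i - x j\<bar>"
    and "\<And>t. t \<in> E \<Longrightarrow> \<exists>i\<in>{1..packing_number E \<epsilon>}. \<bar>t - x i\<bar> < \<epsilon>"
proof -
  define P where "P k \<longleftrightarrow> (\<exists>x :: nat \<Rightarrow> real. (\<forall>i\<in>{1..k}. x i \<in> E) \<and>
        (\<forall>i\<in>{1..k}. \<forall>j\<in>{1..k}. i \<noteq> j \<longrightarrow> \<epsilon> \<le> \<bar>x i - x j\<bar>))" for k
  define K where "K = packing_number E \<epsilon>"
  have K: "K = (GREATEST k. P k)" by (simp add: K_def packing_number_def P_def)
  have bound: "k \<le> nat (\<lfloor>1 / \<epsilon>\<rfloor> + 1)" if "P k" for k
    using that packing_card_le(2)[OF \<epsilon>] E unfolding P_def by blast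
  have "P 0" by (simp add: P_def)
  from GreatestI_nat[where P = P, OF this bound] have "P K" by (simp only: K)
  then obtain x where x: "\<And>i. i \<in> {1..K} \<Longrightarrow> x i \<in> E"
    "\<And>i j. i \<in> {1..K} \<Longrightarrow> j \<in> {1..K} \<Longrightarrow> i \<noteq> j \<Longrightarrow> \<epsilon> \<le> \<bar>x i - x j\<bar>"
    unfolding P_def by blast
  moreover have "\<exists>i\<in>{1..K}. \<bar>t - x i\<bar> < \<epsilon>" if t: "t \<in> E" for t
  proof (rule ccontr)
    assume "\<not> ?thesis"
    then have far: "\<epsilon> \<le> \<bar>t - x i\<bar>" if "i \<in> {1..K}" for i using that by force
    \<comment> \<open>A point of \<open>E\<close> far from all packing points could be appended with
      index \<open>Suc K\<close>.\<close>
    have "P (Suc K)"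
      unfolding P_def
    proof (intro exI[of _ "x(Suc K := t)"] conjI ballI impI)
      show "(x(Suc K := t)) i \<in> E" if "i \<in> {1..Suc K}" for i
        using that t x(1)[of i] by auto
      show "\<epsilon> \<le> \<bar>(x(Suc K := t)) i - (x(Suc K := t)) j\<bar>"
        if "i \<in> {1..Suc K}" "j \<in> {1..Suc K}" "i \<noteq> j" for i j
        using that x(2)[of i j] far[of i] far[of j] by (auto simp: abs_minus_commute)
    qed
    from Greatest_le_nat[where P = P, OF this bound] have "Suc K \<le> K" by (simp only: K)
    then show False by simp
  qed
  ultimately show ?thesis using that unfolding K_def by blast
qed

text \<open>The absolute value is injective on the nonnegative and on the negative integers; each
  half is part of a geometric series.\<close>

lemma sum_powser_abs_int_le:
  fixes q :: real
  assumes q: "0 \<le> q" "q < 1" and S: "finite S"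
  shows "(\<Sum>m\<in>S. q ^ nat \<bar>m\<bar>) \<le> 2 / (1 - q)"
proof -
  have part: "(\<Sum>m\<in>T. q ^ nat \<bar>m\<bar>) \<le> 1 / (1 - q)"
    if T: "finite T" "inj_on (\<lambda>m. nat \<bar>m\<bar>) T" for T :: "int set"
  proof -
    have "(\<Sum>m\<in>T. q ^ nat \<bar>m\<bar>) = (\<Sum>n\<in>(\<lambda>m. nat \<bar>m\<bar>) ` T. q ^ n)"
      using T by (simp add: sum.reindex)
    also have "\<dots> \<le> (\<Sum>n. q ^ n)"
      using q T by (intro sum_le_suminf summable_geometric) auto
    finally show ?thesis using q by (simp add: suminf_geometric)
  qed
  have "S = {m\<in>S. 0 \<le> m} \<union> {m\<in>S. m < 0}" by auto
  then have "(\<Sum>m\<in>S. q ^ nat \<bar>m\<bar>)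
      = (\<Sum>m\<in>{m\<in>S. 0 \<le> m}. q ^ nat \<bar>m\<bar>) + (\<Sum>m\<in>{m\<in>S. m < 0}. q ^ nat \<bar>m\<bar>)"
    using S by (subst sum.union_disjoint[symmetric]) auto
  also have "\<dots> \<le> 1 / (1 - q) + 1 / (1 - q)"
    using S by (intro add_mono part) (auto simp: inj_on_def)
  finally show ?thesis by simp
qed

text \<open>Passing to integer parts lowers a distance to no less than its integer version minus
  one, which costs the factor \<open>exp c\<close>. The integer parts are distinct, so a two-sided
  geometric series bounds the sum.\<close>

lemma sum_exp_separated_le:
  fixes u :: "'i \<Rightarrow> real"
  assumes I: "finite I" and inj: "inj_on (\<lambda>j. \<lfloor>u j\<rfloor>) I" and c: "c > 0"
  shows "(\<Sum>j\<in>I. exp (- (c * \<bar>v - u j\<bar>))) \<le> exp c * (2 / (1 - exp (- c)))"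
proof -
  let ?m = "\<lambda>j. \<lfloor>u j\<rfloor> - \<lfloor>v\<rfloor>"
  have "exp (- (c * \<bar>v - u j\<bar>)) \<le> exp c * exp (- c) ^ nat \<bar>?m j\<bar>" for j
  proof -
    have "real_of_int \<bar>?m j\<bar> - 1 \<le> \<bar>v - u j\<bar>" by linarith
    then have "c * (real_of_int \<bar>?m j\<bar> - 1) \<le> c * \<bar>v - u j\<bar>" using c by (intro mult_left_mono) auto
    then have "exp (- (c * \<bar>v - u j\<bar>)) \<le> exp (c + real (nat \<bar>?m j\<bar>) * (- c))"
      by (simp add: algebra_simps)
    then show ?thesis by (simp only: exp_add exp_of_nat_mult)
  qed
  then have "(\<Sum>j\<in>I. exp (- (c * \<bar>v - u j\<bar>))) \<le> (\<Sum>j\<in>I. exp c * exp (- c) ^ nat \<bar>?m j\<bar>)"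
    by (rule sum_mono)
  also have "\<dots> = exp c * (\<Sum>m\<in>?m ` I. exp (- c) ^ nat \<bar>m\<bar>)"
    using inj by (subst sum.reindex) (auto simp: inj_on_def sum_distrib_left)
  also have "\<dots> \<le> exp c * (2 / (1 - exp (- c)))"
    using I c by (intro mult_left_mono sum_powser_abs_int_le) auto
  finally show ?thesis .
qed

text \<open>Integrate \<open>2 \<lambda> N - \<lambda>\<^sup>2 N\<^sup>2 \<le> 1\<close>, where \<open>N\<close> counts the events that occur and \<open>\<lambda> = 1 / D\<close>.\<close>
lemma (in prob_space) sum_prob_le_prob_Union:
  assumes I: "finite I" and A[measurable]: "\<And>i. i \<in> I \<Longrightarrow> A i \<in> events" and D: "D > 0"
    and second: "(\<Sum>i\<in>I. \<Sum>j\<in>I. prob (A i \<inter> A j)) \<le> D * (\<Sum>i\<in>I. prob (A i))"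
  shows "(\<Sum>i\<in>I. prob (A i)) \<le> D * prob (\<Union>i\<in>I. A i)"
proof -
  let ?N = "\<lambda>\<omega>. \<Sum>i\<in>I. indicator (A i) \<omega> :: real"
  let ?N2 = "\<lambda>\<omega>. \<Sum>i\<in>I. \<Sum>j\<in>I. indicator (A i \<inter> A j) \<omega> :: real"
  have N2: "?N2 \<omega> = (?N \<omega>)\<^sup>2" for \<omega>
    by (simp add: power2_eq_square sum_product indicator_inter_arith)
  have U[measurable]: "(\<Union>i\<in>I. A i) \<in> events" using I by (intro sets.finite_UN) auto
  have int: "integrable M (indicator B :: _ \<Rightarrow> real)" if "B \<in> events" for B
    using that by (simp add: emeasure_finite less_top[symmetric])
  have intN: "integrable M ?N" by (intro Bochner_Integration.integrable_sum int) auto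
  have intN2: "integrable M ?N2" by (intro Bochner_Integration.integrable_sum int) auto
  have "2 / D * (\<Sum>i\<in>I. prob (A i)) - 1 / D\<^sup>2 * (\<Sum>i\<in>I. \<Sum>j\<in>I. prob (A i \<inter> A j))
      = expectation (\<lambda>\<omega>. 2 / D * ?N \<omega> - 1 / D\<^sup>2 * ?N2 \<omega>)"
    using intN intN2
    by (subst Bochner_Integration.integral_diff)
      (auto simp: Bochner_Integration.integral_sum int sets.Int_space_eq2)
  also have "\<dots> \<le> expectation (indicator (\<Union>i\<in>I. A i))"
  proof (rule integral_mono)
    fix \<omega>
    show "2 / D * ?N \<omega> - 1 / D\<^sup>2 * ?N2 \<omega> \<le> indicator (\<Union>i\<in>I. A i) \<omega>"
    proof (cases "\<omega> \<in> (\<Union>i\<in>I. A i)")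
      case True
      have "0 \<le> (1 - ?N \<omega> / D)\<^sup>2" by simp
      then show ?thesis
        using True D unfolding N2 by (simp add: power2_eq_square field_simps)
    next
      case False
      then have "?N \<omega> = 0" by (auto intro!: sum.neutral)
      then show ?thesis unfolding N2 by simp
    qed
  qed (use intN intN2 int in auto)
  also have "\<dots> = prob (\<Union>i\<in>I. A i)" using U by (simp add: sets.Int_space_eq2)
  finally have "2 / D * (\<Sum>i\<in>I. prob (A i)) - 1 / D\<^sup>2 * (\<Sum>i\<in>I. \<Sum>j\<in>I. prob (A i \<inter> A j))
      \<le> prob (\<Union>i\<in>I. A i)" .
  moreover have "1 / D\<^sup>2 * (\<Sum>i\<in>I. \<Sum>j\<in>I. prob (A i \<inter> A j)) \<le> 1 / D\<^sup>2 * (D * (\<Sum>i\<in>I. prob (A i)))"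
    using second by (intro mult_left_mono) auto
  ultimately have "1 / D * (\<Sum>i\<in>I. prob (A i)) \<le> prob (\<Union>i\<in>I. A i)"
    using D by (simp add: power2_eq_square)
  then show ?thesis using D by (simp add: field_simps)
qed

section \<open>Tail estimates for the two bounds\<close>

text \<open>The argument has the form \<open>a * z\<close>, where
  \<open>a\<^sup>2 - 1 = (1 - e) / (1 + e)\<close> with \<open>e = exp (- t)\<close>. For
  \<open>t \<le> 1\<close> this is at least \<open>t / 4\<close>, and \<open>a \<le> 2\<close>
  bounds the prefactor of the scaling estimate.\<close>

lemma std_normal_tail_pair_le:
  assumes t: "0 < t" "t \<le> 1" and z: "z \<ge> 0"
  shows "std_normal_tail (2 * z / sqrt (2 + 2 * exp (- t)))
    \<le> 2 * exp (- (t * z\<^sup>2 / 8)) * std_normal_tail z"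
proof -
  define e where "e = exp (- t)"
  have e: "0 < e" "e < 1" using t by (auto simp: e_def)
  have "e * (1 + t) \<le> 1"
    using exp_ge_add_one_self[of t] by (simp add: e_def exp_minus field_simps)
  then have et: "t / 2 \<le> 1 - e"
  proof -
    \<comment> \<open>The product equals \<open>1 + t * (1 - t) / 2\<close>.\<close>
    have "(1 - t / 2) * (1 + t) \<ge> 1" using t mult_left_le[of t t] by (simp add: field_simps)
    then have "e * (1 + t) \<le> (1 - t / 2) * (1 + t)" using \<open>e * (1 + t) \<le> 1\<close> by linarith
    then have "e \<le> 1 - t / 2" using t by (simp add: mult_le_cancel_right)
    then show ?thesis by simp
  qed
  define a where "a = 2 / sqrt (2 + 2 * e)"
  have a2: "a\<^sup>2 = 2 / (1 + e)" using e by (simp add: a_def power_divide field_simps)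
  have a0: "a > 0" using e by (simp add: a_def)
  have a1: "1 \<le> a" using e a0 by (intro power2_le_imp_le[of 1]) (auto simp: a2 field_simps)
  have a3: "a \<le> 2" using e by (intro power2_le_imp_le[of a]) (auto simp: a2 field_simps)
  have "(1 - e) / 2 \<le> (1 - e) / (1 + e)" using e by (intro divide_left_mono) auto
  also have "\<dots> = a\<^sup>2 - 1" using e by (simp add: a2 field_simps)
  finally have "t / 4 \<le> a\<^sup>2 - 1" using et by simp
  then have "t / 4 * z\<^sup>2 \<le> (a\<^sup>2 - 1) * z\<^sup>2" by (rule mult_right_mono) simp
  then have "exp (- ((a\<^sup>2 - 1) * z\<^sup>2 / 2)) \<le> exp (- (t * z\<^sup>2 / 8))" by simp
  with a0 a3 have "a * exp (- ((a\<^sup>2 - 1) * z\<^sup>2 / 2)) \<le> 2 * exp (- (t * z\<^sup>2 / 8))"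
    by (intro mult_mono) auto
  then have "a * exp (- ((a\<^sup>2 - 1) * z\<^sup>2 / 2)) * std_normal_tail z
      \<le> 2 * exp (- (t * z\<^sup>2 / 8)) * std_normal_tail z"
    by (rule mult_right_mono) (simp add: std_normal_tail_eq)
  with std_normal_tail_scale_le[OF a1 z] show ?thesis
    by (simp add: a_def e_def)
qed

text \<open>The contraction moves \<open>z\<close> by at most \<open>2 / z\<close>, so
  \<open>y * (z - y)\<close> stays bounded; \<open>z > 1\<close> keeps \<open>z - y\<close> below
  \<open>2\<close> and \<open>y\<close> away from \<open>0\<close>.\<close>

lemma std_normal_tail_shrink_le:
  assumes z: "z > 1"
  shows "std_normal_tail (exp (- (2 / z\<^sup>2)) * z) \<le> 2 * exp (4 + 2 * exp 2) * std_normal_tail z"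
proof -
  define y where "y = exp (- (2 / z\<^sup>2)) * z"
  have z2: "2 / z\<^sup>2 \<le> 2" using z by (simp add: field_simps)
  have "exp (- 2) * z \<le> y" unfolding y_def using z z2 by (intro mult_right_mono) auto
  then have ly: "exp (- 2) \<le> y" using z by (smt (verit) exp_gt_zero mult_le_cancel_left1)
  have y0: "y > 0" using z by (simp add: y_def)
  have yz: "y \<le> z" unfolding y_def using z by (simp add: mult_le_cancel_right1)
  have "(1 - exp (- (2 / z\<^sup>2))) * z \<le> 2 / z\<^sup>2 * z"
    using z exp_ge_add_one_self[of "- (2 / z\<^sup>2)"] by (intro mult_right_mono) auto
  then have d: "z - y \<le> 2 / z" using z by (simp add: y_def algebra_simps power2_eq_square)
  have "2 / z \<le> 2" using z by (simp add: divide_le_eq)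
  with d have d2: "z - y \<le> 2" by linarith
  have "1 / y \<le> exp 2"
    using ly y0 by (simp add: exp_minus field_simps)
  then have "1 / y * (z - y) \<le> exp 2 * 2"
    using d2 yz y0 by (intro mult_mono) auto
  moreover have "y * (z - y) \<le> z * (2 / z)" using d yz y0 z by (intro mult_mono) auto
  then have "y * (z - y) \<le> 2" using z by simp
  moreover have "(z - y)\<^sup>2 \<le> 2\<^sup>2" using d2 yz by (intro power_mono) auto
  \<comment> \<open>The contributions are \<open>2\<close> from \<open>y * (z - y)\<close>,
    \<open>2 * exp 2\<close> from \<open>(z - y) / y\<close> and \<open>2\<close> from the
    square.\<close>
  ultimately have "(y + 1 / y) * (z - y) + (z - y)\<^sup>2 / 2 \<le> 4 + 2 * exp 2"
    by (simp only: distrib_right) simp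
  then have "2 * exp ((y + 1 / y) * (z - y) + (z - y)\<^sup>2 / 2) * std_normal_tail z
      \<le> 2 * exp (4 + 2 * exp 2) * std_normal_tail z"
    by (intro mult_right_mono mult_left_mono) (auto simp: std_normal_tail_eq)
  with std_normal_tail_le_tail[OF y0 yz] show ?thesis unfolding y_def by linarith
qed

section \<open>Upper and lower bounds for the supremum\<close>

context ou_process begin

text \<open>A union bound over the intervals around the packing points. A factor \<open>2\<close>
  comes from the maximal inequality, the factor \<open>2 * exp (4 + 2 * exp 2)\<close> from
  shrinking the threshold.\<close>

lemma prob_sup_le:
  assumes E: "closed E" "E \<noteq> {}" "E \<subseteq> {0..1}" and z: "z > 1"
  shows "prob {\<omega> \<in> space M. z \<le> (SUP t\<in>E. Z t \<omega>)}
    \<le> 4 * exp (4 + 2 * exp 2) * real (packing_number E (1 / z\<^sup>2)) * std_normal_tail z"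
proof -
  define \<delta> where "\<delta> = 1 / z\<^sup>2"
  have \<delta>: "\<delta> > 0" using z by (simp add: \<delta>_def)
  define K where "K = packing_number E \<delta>"
  obtain x where x: "\<And>i. i \<in> {1..K} \<Longrightarrow> x i \<in> E"
    and cover: "\<And>t. t \<in> E \<Longrightarrow> \<exists>i\<in>{1..K}. \<bar>t - x i\<bar> < \<delta>"
    unfolding K_def by (rule packing_number_attained[OF E(3) \<delta>]) blast
  have E0: "E \<subseteq> {0..}" "compact E"
    using E bounded_subset[OF bounded_closed_interval E(3)] by (auto simp: compact_eq_bounded_closed)
  \<comment> \<open>Cut off at \<open>0\<close>, since the process is controlled only at nonnegative
    times.\<close>
  define a where "a i = max 0 (x i - \<delta>)" for i
  define b where "b i = x i + \<delta>" for i
  have ab: "0 \<le> a i" "a i < b i" "- (2 / z\<^sup>2) \<le> a i - b i" if "i \<in> {1..K}" for i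
  proof -
    have "0 \<le> x i" "2 / z\<^sup>2 = 2 * \<delta>" using x[OF that] E(3) by (auto simp: \<delta>_def)
    then show "0 \<le> a i" "a i < b i" "- (2 / z\<^sup>2) \<le> a i - b i"
      using \<delta> by (auto simp: a_def b_def)
  qed
  define B where "B i = {\<omega> \<in> space M. \<exists>t\<in>{a i..b i}. z \<le> Z t \<omega>}" for i
  have B: "B i \<in> events" if "i \<in> {1..K}" for i
    unfolding B_def using ab[OF that] by (intro ex_Z_ge_measurable) auto
  have "prob {\<omega> \<in> space M. z \<le> (SUP t\<in>E. Z t \<omega>)} \<le> prob (\<Union>i\<in>{1..K}. B i)"
  proof (rule finite_measure_mono)
    show "{\<omega> \<in> space M. z \<le> (SUP t\<in>E. Z t \<omega>)} \<subseteq> (\<Union>i\<in>{1..K}. B i)"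
    proof
      fix \<omega> assume "\<omega> \<in> {\<omega> \<in> space M. z \<le> (SUP t\<in>E. Z t \<omega>)}"
      then have "\<omega> \<in> space M" "\<exists>t\<in>E. z \<le> Z t \<omega>"
        using SUP_Z_ge_iff[OF E0(2) E(2) E0(1)] by auto
      then obtain t where t: "\<omega> \<in> space M" "t \<in> E" "z \<le> Z t \<omega>" by auto
      from cover[OF t(2)] obtain i where i: "i \<in> {1..K}" "\<bar>t - x i\<bar> < \<delta>" by auto
      have "t \<in> {a i..b i}" using i(2) t(2) E(3) by (auto simp: a_def b_def)
      with t have "\<omega> \<in> B i" unfolding B_def by blast
      with i(1) show "\<omega> \<in> (\<Union>i\<in>{1..K}. B i)" by blast
    qed
  qed (use B in auto)
  also have "\<dots> \<le> (\<Sum>i\<in>{1..K}. prob (B i))"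
    using B by (intro finite_measure_subadditive_finite) auto
  also have "\<dots> \<le> (\<Sum>i\<in>{1..K}. 2 * (2 * exp (4 + 2 * exp 2) * std_normal_tail z))"
  proof (rule sum_mono)
    fix i assume i: "i \<in> {1..K}"
    have "prob (B i) \<le> 2 * std_normal_tail (exp (a i - b i) * z)"
      unfolding B_def using ab[OF i] z by (intro prob_ex_Z_ge_le) auto
    also have "std_normal_tail (exp (a i - b i) * z) \<le> std_normal_tail (exp (- (2 / z\<^sup>2)) * z)"
      using ab(3)[OF i] z by (intro std_normal_tail_antimono mult_right_mono) auto
    also have "\<dots> \<le> 2 * exp (4 + 2 * exp 2) * std_normal_tail z"
      by (rule std_normal_tail_shrink_le[OF z])
    finally show "prob (B i) \<le> 2 * (2 * exp (4 + 2 * exp 2) * std_normal_tail z)" by simp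
  qed
  finally show ?thesis by (simp add: K_def \<delta>_def mult_ac)
qed

text \<open>The second moment bound needs each row sum of the pair probabilities to be comparable to
  a single tail; the separation of the packing points provides this.\<close>

lemma prob_sup_ge:
  assumes E: "closed E" "E \<noteq> {}" "E \<subseteq> {0..1}" and z: "z > 1"
  shows "real (packing_number E (1 / z\<^sup>2)) * std_normal_tail z
    \<le> 4 * exp (1 / 8) / (1 - exp (- (1 / 8))) * prob {\<omega> \<in> space M. z \<le> (SUP t\<in>E. Z t \<omega>)}"
proof -
  define \<delta> where "\<delta> = 1 / z\<^sup>2"
  have \<delta>: "\<delta> > 0" using z by (simp add: \<delta>_def)
  define K where "K = packing_number E \<delta>"
  obtain x where x: "\<And>i. i \<in> {1..K} \<Longrightarrow> x i \<in> E"
    and sep: "\<And>i j. i \<in> {1..K} \<Longrightarrow> j \<in> {1..K} \<Longrightarrow> i \<noteq> j \<Longrightarrow> \<delta> \<le> \<bar>x i - x j\<bar>"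
    unfolding K_def by (rule packing_number_attained[OF E(3) \<delta>]) blast
  have x01: "x i \<in> {0..1}" if "i \<in> {1..K}" for i using x[OF that] E(3) by auto
  have E0: "E \<subseteq> {0..}" "compact E"
    using E bounded_subset[OF bounded_closed_interval E(3)] by (auto simp: compact_eq_bounded_closed)
  define A where "A i = {\<omega> \<in> space M. z \<le> Z (x i) \<omega>}" for i
  have A: "A i \<in> events" if "i \<in> {1..K}" for i
  proof -
    have [measurable]: "Z (x i) \<in> borel_measurable M" using x01[OF that] by simp
    show ?thesis unfolding A_def by measurable
  qed
  have pA: "prob (A i) = std_normal_tail z" if "i \<in> {1..K}" for i
    unfolding A_def using x01[OF that] by (intro Z_tail) auto
  have tail0: "0 \<le> std_normal_tail z" by (simp add: std_normal_tail_eq)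
  \<comment> \<open>In units of \<open>\<delta>\<close> the points have distinct integer parts, and
    \<open>\<bar>x i - x j\<bar> * z\<^sup>2\<close> becomes
    \<open>\<bar>u i - u j\<bar>\<close>.\<close>
  define u where "u i = x i / \<delta>" for i
  have pAA: "prob (A i \<inter> A j) \<le> 2 * exp (- (1 / 8 * \<bar>u i - u j\<bar>)) * std_normal_tail z"
    if i: "i \<in> {1..K}" and j: "j \<in> {1..K}" for i j
  proof (cases "i = j")
    \<comment> \<open>On the diagonal the exponential is \<open>1\<close>, and the factor
      \<open>2\<close> leaves room.\<close>
    case True
    then show ?thesis using pA[OF i] tail0 by simp
  next
    case False
    let ?t = "\<bar>x i - x j\<bar>"
    have t: "0 < ?t" "?t \<le> 1" using sep[OF i j False] \<delta> x01[OF i] x01[OF j] by auto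
    have ij: "0 \<le> x i" "0 \<le> x j" using x01[OF i] x01[OF j] by auto
    have "prob (A i \<inter> A j) \<le> prob {\<omega> \<in> space M. 2 * z \<le> Z (x i) \<omega> + Z (x j) \<omega>}"
    proof (rule finite_measure_mono)
      have [measurable]: "Z (x i) \<in> borel_measurable M" "Z (x j) \<in> borel_measurable M"
        using ij by auto
      show "{\<omega> \<in> space M. 2 * z \<le> Z (x i) \<omega> + Z (x j) \<omega>} \<in> events" by measurable
    qed (auto simp: A_def)
    also have "\<dots> \<le> std_normal_tail (2 * z / sqrt (2 + 2 * exp (- ?t)))"
      using t ij by (intro Z_plus_Z_tail_le) auto
    also have "\<dots> \<le> 2 * exp (- (?t * z\<^sup>2 / 8)) * std_normal_tail z"
      using t z by (intro std_normal_tail_pair_le) auto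
    also have "?t * z\<^sup>2 / 8 = 1 / 8 * \<bar>u i - u j\<bar>"
      using z by (simp add: u_def \<delta>_def left_diff_distrib[symmetric] abs_mult)
    finally show ?thesis .
  qed
  \<comment> \<open>The factor \<open>2\<close> of the pair bound times the bound of
    \<open>sum_exp_separated_le\<close> at rate \<open>1 / 8\<close>.\<close>
  define D :: real where "D = 4 * exp (1 / 8) / (1 - exp (- (1 / 8)))"
  have D: "D > 0" by (simp add: D_def)
  have "(\<Sum>i\<in>{1..K}. prob (A i)) \<le> D * prob (\<Union>i\<in>{1..K}. A i)"
  proof (rule sum_prob_le_prob_Union[OF _ A D])
    have "(\<Sum>j\<in>{1..K}. prob (A i \<inter> A j)) \<le> D * prob (A i)" if i: "i \<in> {1..K}" for i
    proof -
      have "(\<Sum>j\<in>{1..K}. prob (A i \<inter> A j))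
          \<le> (\<Sum>j\<in>{1..K}. 2 * exp (- (1 / 8 * \<bar>u i - u j\<bar>)) * std_normal_tail z)"
        by (intro sum_mono pAA i)
      also have "\<dots> = 2 * (\<Sum>j\<in>{1..K}. exp (- (1 / 8 * \<bar>u i - u j\<bar>))) * std_normal_tail z"
        by (simp add: sum_distrib_left sum_distrib_right)
      also have "\<dots> \<le> 2 * (exp (1 / 8) * (2 / (1 - exp (- (1 / 8))))) * std_normal_tail z"
        using packing_card_le(1)[OF \<delta> x01 sep] tail0
        by (intro mult_right_mono mult_left_mono sum_exp_separated_le) (auto simp: u_def)
      also have "\<dots> = D * prob (A i)" using pA[OF i] by (simp add: D_def)
      finally show ?thesis .
    qed
    then show "(\<Sum>i\<in>{1..K}. \<Sum>j\<in>{1..K}. prob (A i \<inter> A j)) \<le> D * (\<Sum>i\<in>{1..K}. prob (A i))"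
      unfolding sum_distrib_left by (rule sum_mono)
  qed simp_all
  moreover have "prob (\<Union>i\<in>{1..K}. A i) \<le> prob {\<omega> \<in> space M. z \<le> (SUP t\<in>E. Z t \<omega>)}"
  proof (rule finite_measure_mono)
    show "(\<Union>i\<in>{1..K}. A i) \<subseteq> {\<omega> \<in> space M. z \<le> (SUP t\<in>E. Z t \<omega>)}"
    proof
      fix \<omega> assume "\<omega> \<in> (\<Union>i\<in>{1..K}. A i)"
      then obtain i where i: "i \<in> {1..K}" and "\<omega> \<in> space M" "z \<le> Z (x i) \<omega>"
        unfolding A_def by blast
      with x[OF i] show "\<omega> \<in> {\<omega> \<in> space M. z \<le> (SUP t\<in>E. Z t \<omega>)}"
        by (auto simp: SUP_Z_ge_iff[OF E0(2) E(2) E0(1)])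
    qed
    have "{\<omega> \<in> space M. z \<le> (SUP t\<in>E. Z t \<omega>)} = {\<omega> \<in> space M. \<exists>t\<in>E. z \<le> Z t \<omega>}"
      by (auto simp: SUP_Z_ge_iff[OF E0(2) E(2) E0(1)])
    then show "{\<omega> \<in> space M. z \<le> (SUP t\<in>E. Z t \<omega>)} \<in> events"
      using ex_Z_ge_measurable[OF E0(2,1)] by simp
  qed
  then have "D * prob (\<Union>i\<in>{1..K}. A i) \<le> D * prob {\<omega> \<in> space M. z \<le> (SUP t\<in>E. Z t \<omega>)}"
    using D by (intro mult_left_mono) auto
  moreover have "(\<Sum>i\<in>{1..K}. prob (A i)) = real K * std_normal_tail z" using pA by simp
  ultimately show ?thesis unfolding D_def K_def \<delta>_def by linarith
qed

end

theorem corollary1p3: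
  fixes M :: "'a measure" and Z :: "real \<Rightarrow> 'a \<Rightarrow> real"
  assumes "stationary_ou_process M Z"
  shows "\<exists>A::real. A > 1 \<and>
    (\<forall>(E::real set) (z::real). E \<noteq> {} \<and> closed E \<and> E \<subseteq> {0..1} \<and> z > 1 \<longrightarrow>
       inverse A * real (packing_number E (1 / z\<^sup>2)) * std_normal_tail z
         \<le> measure M {\<omega> \<in> space M. (SUP t\<in>E. Z t \<omega>) \<ge> z} \<and>
       measure M {\<omega> \<in> space M. (SUP t\<in>E. Z t \<omega>) \<ge> z}
         \<le> A * real (packing_number E (1 / z\<^sup>2)) * std_normal_tail z)"
proof -
  obtain W where W: "brownian_motion M W" "ou_solution M W Z"
    using assms by (auto simp: stationary_ou_process_def)
  interpret prob_space M using assms by (simp add: stationary_ou_process_def)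
  interpret ou_process M Z W
    using assms W by unfold_locales (auto simp: stationary_ou_process_def)
  \<comment> \<open>Explicit numbers from the upper and the lower bound, independent of the process,
    of \<open>E\<close> and of \<open>z\<close>. Their sum serves both sides, because the quantities
    compared are nonnegative.\<close>
  define C D :: real where "C = 4 * exp (4 + 2 * exp 2)"
    and "D = 4 * exp (1 / 8) / (1 - exp (- (1 / 8)))"
  have C: "C > 1" using exp_ge_add_one_self[of "4 + 2 * exp 2 :: real"] exp_gt_zero[of "2 :: real"]
    unfolding C_def by linarith
  have D: "D > 0" by (simp add: D_def)
  show ?thesis
  proof (intro exI[of _ "C + D"] conjI allI impI)
    show "C + D > 1" using C D by simp
    fix E :: "real set" and z :: real
    assume "E \<noteq> {} \<and> closed E \<and> E \<subseteq> {0..1} \<and> z > 1"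
    then have E: "closed E" "E \<noteq> {}" "E \<subseteq> {0..1}" and z: "z > 1" by auto
    let ?P = "prob {\<omega> \<in> space M. (SUP t\<in>E. Z t \<omega>) \<ge> z}"
    let ?K = "real (packing_number E (1 / z\<^sup>2)) * std_normal_tail z"
    have K: "0 \<le> ?K" by (simp add: std_normal_tail_eq)
    have "?K \<le> D * ?P" using prob_sup_ge[OF E z] by (simp add: D_def)
    also have "\<dots> \<le> (C + D) * ?P" using C by (intro mult_right_mono) auto
    finally show "inverse (C + D) * real (packing_number E (1 / z\<^sup>2)) * std_normal_tail z \<le> ?P"
      using C D by (simp add: field_simps)
    have "?P \<le> C * ?K" using prob_sup_le[OF E z] by (simp add: C_def mult.assoc)
    also have "\<dots> \<le> (C + D) * ?K" using D K by (intro mult_right_mono) auto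
    finally show "?P \<le> (C + D) * real (packing_number E (1 / z\<^sup>2)) * std_normal_tail z"
      by (simp add: mult.assoc)
  qed
qed

end
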